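(* Let $G = \langle x, y, t \mid x^y = x^2,\ x^t = y\rangle$ be the Baumslag-Gersten group and let $H = \langle x, y\rangle \le G$. Then $\mathrm{Out}(G)$ is isomorphic to $C_H(x)$. An isomorphism $\phi : C_H(x) \to \mathrm{Out}(G)$ is given by $\phi(g) = [F_g]$, where $F_g : G \to G$, defined by $x \mapsto x$, $y \mapsto y$, $t \mapsto g t$, is an automorphism of $G$ and $[F_g]$ denotes its class in $\mathrm{Out}(G)$.
   Context: Notation: $a^b = b^{-1} a b$. $\mathrm{Out}(G) = \mathrm{Aut}(G)/\mathrm{Inn}(G)$. $G$ is an HNN extension, with stable letter $t$, of the Baumslag-Solitar group presented by $\langle x, y \mid x^y = x^2 \rangle$; this group embeds in $G$ as the subgroup $\langle x,y\rangle$ generated by $x$ and $y$, and is identified with it and denoted $H$. $C_H(x) = \{h \in H : hx = xh\}$ is the centralizer of $x$ in $H$. *)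

theory Defs
  imports "HOL-Algebra.Bij" "HOL-Algebra.Coset" "HOL-Algebra.Generated_Groups"
begin

section \<open>Free groups and presentations\<close>

text \<open>The letter \<open>(a, True)\<close> stands for the generator \<open>a\<close>, the letter \<open>(a, False)\<close> for its formal
  inverse. The set of generators is the whole type \<open>'a\<close>.\<close>

type_synonym 'a word = "('a \<times> bool) list"

inductive cancel_step :: "'a word \<Rightarrow> 'a word \<Rightarrow> bool" where
  "cancel_step (u @ [(a, b), (a, \<not> b)] @ v) (u @ v)"

definition free_eq :: "('a word \<times> 'a word) set" where
  "free_eq = {(u, v). equivclp cancel_step u v}"

definition free_group :: "'a word set monoid" where
  "free_group =
    \<lparr>carrier = UNIV // free_eq,
     mult = (\<lambda>A B. \<Union>u\<in>A. \<Union>v\<in>B. free_eq `` {u @ v}),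
     one = free_eq `` {[]}\<rparr>"

definition free_gen :: "'a \<Rightarrow> 'a word set" where
  "free_gen a = free_eq `` {[(a, True)]}"

definition normal_closure :: "('a, 'b) monoid_scheme \<Rightarrow> 'a set \<Rightarrow> 'a set" where
  "normal_closure G S = \<Inter>{N. N \<lhd> G \<and> S \<subseteq> N}"

text \<open>A pair \<open>(u, v)\<close> in \<open>R\<close> is the defining relation \<open>u = v\<close>.\<close>

definition relator_closure :: "('a word set \<times> 'a word set) set \<Rightarrow> 'a word set set" where
  "relator_closure R =
    normal_closure free_group {u \<otimes>\<^bsub>free_group\<^esub> inv\<^bsub>free_group\<^esub> v | u v. (u, v) \<in> R}"

definition presented_group :: "('a word set \<times> 'a word set) set \<Rightarrow> 'a word set set monoid" where
  "presented_group R = free_group Mod relator_closure R"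

definition presented_gen :: "('a word set \<times> 'a word set) set \<Rightarrow> 'a \<Rightarrow> 'a word set set" where
  "presented_gen R a = relator_closure R #>\<^bsub>free_group\<^esub> free_gen a"

definition conj_by :: "('a, 'b) monoid_scheme \<Rightarrow> 'a \<Rightarrow> 'a \<Rightarrow> 'a" where
  "conj_by G a b = inv\<^bsub>G\<^esub> b \<otimes>\<^bsub>G\<^esub> a \<otimes>\<^bsub>G\<^esub> b"


section \<open>Outer automorphisms\<close>

definition Inn :: "('a, 'b) monoid_scheme \<Rightarrow> ('a \<Rightarrow> 'a) set" where
  "Inn G = {(\<lambda>h\<in>carrier G. g \<otimes>\<^bsub>G\<^esub> h \<otimes>\<^bsub>G\<^esub> inv\<^bsub>G\<^esub> g) | g. g \<in> carrier G}"

definition Out :: "('a, 'b) monoid_scheme \<Rightarrow> ('a \<Rightarrow> 'a) set monoid" where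
  "Out G = AutoGroup G Mod Inn G"

definition out_class :: "('a, 'b) monoid_scheme \<Rightarrow> ('a \<Rightarrow> 'a) \<Rightarrow> ('a \<Rightarrow> 'a) set" where
  "out_class G f = Inn G #>\<^bsub>AutoGroup G\<^esub> f"


section \<open>The Baumslag-Gersten group\<close>

datatype gen = Gx | Gy | Gt

definition BG_rels :: "(gen word set \<times> gen word set) set" where
  "BG_rels =
    {(conj_by free_group (free_gen Gx) (free_gen Gy), free_gen Gx [^]\<^bsub>free_group\<^esub> (2::nat)),
     (conj_by free_group (free_gen Gx) (free_gen Gt), free_gen Gy)}"

definition BG :: "gen word set set monoid" where
  "BG = presented_group BG_rels"

definition BG_x :: "gen word set set" where "BG_x = presented_gen BG_rels Gx"
definition BG_y :: "gen word set set" where "BG_y = presented_gen BG_rels Gy"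
definition BG_t :: "gen word set set" where "BG_t = presented_gen BG_rels Gt"

definition BG_H :: "gen word set set set" where
  "BG_H = generate BG {BG_x, BG_y}"

definition BG_C :: "gen word set set set" where
  "BG_C = {h \<in> BG_H. h \<otimes>\<^bsub>BG\<^esub> BG_x = BG_x \<otimes>\<^bsub>BG\<^esub> h}"

text \<open>Automorphisms in \<^const>\<open>auto\<close> are extensional, i.e. \<open>undefined\<close> outside the carrier; endomorphisms
  are normalised in the same way, so that they are determined by their values on the group.\<close>

definition is_BG_endo :: "gen word set set \<Rightarrow> (gen word set set \<Rightarrow> gen word set set) \<Rightarrow> bool" where
  "is_BG_endo g F \<longleftrightarrow>
    F \<in> hom BG BG \<and> F \<in> extensional (carrier BG) \<and>
    F BG_x = BG_x \<and> F BG_y = BG_y \<and> F BG_t = g \<otimes>\<^bsub>BG\<^esub> BG_t"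

definition BG_F :: "gen word set set \<Rightarrow> gen word set set \<Rightarrow> gen word set set" where
  "BG_F g = (THE F. is_BG_endo g F)"

end

(* van der Waerden's permutation representation on normal forms gives Britton's lemma for G as an
   HNN extension of H, where H is faithfully represented by the affine maps v |-> q + v/2^n.

   If a is nontrivial and a^b = a^2, then a is conjugate into H, since otherwise the length of
   a^(2^k), a conjugate of a by b^k, would grow both exponentially and at most linearly in k; and then
   Britton's lemma shows that a and b are simultaneously conjugate into H.  Hence, up to an inner
   automorphism, every automorphism f maps x and y into H.  A further conjugation makes f(y) = y, and
   then the element f(t) t^-1 conjugates f(x) to x, so by Britton's lemma it lies in H;
   conjugation by a power of y makes f(x) = x, and f(t) t^-1 centralises x.  The map g |-> [F_g] is
   injective because the centraliser of H in G is trivial. *)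

theory Submission
  imports Defs Complex_Main
begin

section \<open>Free groups and presentations\<close>

text \<open>On H everything is read off from affine maps: powers of x are the integral translations,
  powers of y the maps in H fixing 0, and the slope 2^-n gives the homomorphism from H to the
  integers with x \<mapsto> 0, y \<mapsto> 1. If f(x) and f(y) lie in H, the first relation makes
  f(x) a translation by some q \<noteq> 0 and gives f(y) slope 1/2; moving the fixed point of f(y)
  to 0 makes f(y) = y. The value of q is controlled only through t: the element f(t) t^-1 of H
  conjugates translation by q to translation by 1, so q is an integral power of 2 and a power of y
  finishes.

  The rational q is not confined to dyadic numbers. The permutations act on normal forms over a
  larger affine group, where coset representatives are given by \<open>frac\<close> and by scaling;
  only the copy of H inside it has to be faithful.

  The composite F_g F_h sends t to h g t, so that g \<mapsto> F_g is a homomorphism rests on C_H(x)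
  being abelian: it consists of translations.\<close>

lemma equiv_free_eq: "equiv UNIV free_eq"
proof (rule equivI)
  show "refl free_eq" by (auto simp: refl_on_def free_eq_def)
  show "sym free_eq" by (auto simp: sym_def free_eq_def intro: equivclp_sym)
  show "trans free_eq" by (auto simp: trans_def free_eq_def intro: equivclp_trans)
qed simp

lemma cancel_step_append:
  assumes "cancel_step u v"
  shows "cancel_step (p @ u @ q) (p @ v @ q)"
  using assms
proof cases
  case (1 u' a b v')
  then show ?thesis
    using cancel_step.intros[of "p @ u'" a b "v' @ q"] by simp
qed

lemma free_eq_append1:
  assumes "(u, v) \<in> free_eq"
  shows "(p @ u @ q, p @ v @ q) \<in> free_eq"
proof -
  have "equivclp cancel_step u v" using assms by (simp add: free_eq_def)
  then have "equivclp cancel_step (p @ u @ q) (p @ v @ q)"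
  proof (induction rule: equivclp_induct)
    case (step y z)
    then have "equivclp cancel_step (p @ y @ q) (p @ z @ q)"
      by (meson cancel_step_append converse_r_into_equivclp r_into_equivclp)
    with step.IH show ?case by (rule equivclp_trans)
  qed simp
  then show ?thesis by (simp add: free_eq_def)
qed

lemma free_eq_append:
  assumes "(u, u') \<in> free_eq" "(v, v') \<in> free_eq"
  shows "(u @ v, u' @ v') \<in> free_eq"
  using free_eq_append1[OF assms(1), of "[]" v] free_eq_append1[OF assms(2), of u' "[]"]
    equiv_free_eq by (auto simp: equiv_def dest: transD)

lemma mult_free_group:
  "free_eq `` {u} \<otimes>\<^bsub>free_group\<^esub> free_eq `` {v} = free_eq `` {u @ v}"
proof -
  have *: "free_eq `` {p @ q} = free_eq `` {u @ v}"
    if "(u, p) \<in> free_eq" "(v, q) \<in> free_eq" for p q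
    by (rule equiv_class_eq[OF equiv_free_eq free_eq_append[OF that], symmetric])
  have "u \<in> free_eq `` {u}" "v \<in> free_eq `` {v}"
    using equiv_class_self[OF equiv_free_eq] by auto
  have "(\<Union>p\<in>free_eq `` {u}. \<Union>q\<in>free_eq `` {v}. free_eq `` {p @ q})
      = (\<Union>p\<in>free_eq `` {u}. \<Union>q\<in>free_eq `` {v}. free_eq `` {u @ v})"
    using * by (intro SUP_cong refl) auto
  also have "\<dots> = free_eq `` {u @ v}"
    using \<open>u \<in> _\<close> \<open>v \<in> _\<close> by (metis UN_constant empty_iff)
  finally show ?thesis by (simp add: free_group_def)
qed

lemma carrier_free_group: "A \<in> carrier free_group \<longleftrightarrow> (\<exists>u. A = free_eq `` {u})"
  by (auto simp: free_group_def quotient_def)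

lemma one_free_group: "\<one>\<^bsub>free_group\<^esub> = free_eq `` {[]}"
  by (simp add: free_group_def)

lemma free_eq_cancel: "free_eq `` {(a, b) # (a, \<not> b) # v} = free_eq `` {v}"
proof -
  have "cancel_step ([] @ [(a, b), (a, \<not> b)] @ v) ([] @ v)" by (rule cancel_step.intros)
  then have "((a, b) # (a, \<not> b) # v, v) \<in> free_eq" by (auto simp: free_eq_def)
  then show ?thesis by (rule equiv_class_eq[OF equiv_free_eq])
qed

definition word_inv :: "'a word \<Rightarrow> 'a word" where
  "word_inv u = rev (map (\<lambda>(a, b). (a, \<not> b)) u)"

lemma word_inv_append: "free_eq `` {word_inv u @ u @ v} = free_eq `` {v}"
proof (induction u arbitrary: v)
  case (Cons p u)
  obtain a b where p: "p = (a, b)" by force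
  have "((a, \<not> b) # (a, \<not> \<not> b) # u @ v, u @ v) \<in> free_eq"
    using free_eq_cancel[of a "\<not> b" "u @ v"] by (metis UNIV_I eq_equiv_class_iff equiv_free_eq)
  then have "(word_inv u @ ((a, \<not> b) # (a, b) # u @ v) @ [], word_inv u @ (u @ v) @ []) \<in> free_eq"
    using free_eq_append1 by fastforce
  then have "free_eq `` {word_inv (p # u) @ (p # u) @ v} = free_eq `` {word_inv u @ u @ v}"
    by (intro equiv_class_eq[OF equiv_free_eq]) (simp add: p word_inv_def)
  with Cons show ?case by simp
qed (simp add: word_inv_def)

lemma group_free_group: "group (free_group :: 'a word set monoid)"
proof (rule groupI)
  fix A :: "'a word set" assume "A \<in> carrier free_group"
  then obtain u where "A = free_eq `` {u}" by (auto simp: carrier_free_group)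
  then have "free_eq `` {word_inv u} \<otimes>\<^bsub>free_group\<^esub> A = \<one>\<^bsub>free_group\<^esub>"
    using word_inv_append[of u "[]"] by (simp add: mult_free_group one_free_group)
  then show "\<exists>B\<in>carrier free_group. B \<otimes>\<^bsub>free_group\<^esub> A = \<one>\<^bsub>free_group\<^esub>"
    using carrier_free_group by blast
qed (auto simp: carrier_free_group mult_free_group one_free_group)

lemma inv_free_gen: "inv\<^bsub>free_group\<^esub> (free_gen a) = free_eq `` {[(a, False)]}"
proof (rule group.inv_equality[OF group_free_group])
  show "free_eq `` {[(a, False)]} \<otimes>\<^bsub>free_group\<^esub> free_gen a = \<one>\<^bsub>free_group\<^esub>"
    using free_eq_cancel[of a False "[]"] by (simp add: free_gen_def mult_free_group one_free_group)
qed (auto simp: carrier_free_group free_gen_def)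

lemma free_gen_closed: "free_gen a \<in> carrier free_group"
  by (auto simp: carrier_free_group free_gen_def)

lemma generate_free_group:
  "generate free_group (range (free_gen :: 'a \<Rightarrow> 'a word set)) = carrier free_group"
proof
  show "generate free_group (range free_gen) \<subseteq> carrier free_group"
    by (rule group.generate_incl[OF group_free_group]) (auto simp: free_gen_closed)
  have "free_eq `` {u} \<in> generate free_group (range free_gen)" for u :: "'a word"
  proof (induction u)
    case Nil
    show ?case unfolding one_free_group[symmetric] by (rule generate.one)
  next
    case (Cons p u)
    obtain a b where p: "p = (a, b)" by force
    have "free_eq `` {[p]} \<in> generate free_group (range free_gen)"
    proof (cases b)
      case True
      then show ?thesis
        unfolding p using generate.incl[OF rangeI[of free_gen a], of free_group] by (simp add: free_gen_def)
    next
      case False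
      then show ?thesis
        unfolding p using generate.inv[OF rangeI[of free_gen a], of free_group] by (simp add: inv_free_gen)
    qed
    from generate.eng[OF this Cons] show ?case by (simp add: mult_free_group)
  qed
  then show "carrier free_group \<subseteq> generate free_group (range (free_gen :: 'a \<Rightarrow> 'a word set))"
    by (auto simp: carrier_free_group)
qed

section \<open>Evaluation of words and the universal property of free groups\<close>

definition eval_word :: "('k, 'm) monoid_scheme \<Rightarrow> ('a \<Rightarrow> 'k) \<Rightarrow> 'a word \<Rightarrow> 'k" where
  "eval_word K f w =
    foldr (\<lambda>(a, b) r. (if b then f a else inv\<^bsub>K\<^esub> (f a)) \<otimes>\<^bsub>K\<^esub> r) w \<one>\<^bsub>K\<^esub>"

context group
begin

lemma l_inv_cancel: "a \<in> carrier G \<Longrightarrow> b \<in> carrier G \<Longrightarrow> inv a \<otimes> (a \<otimes> b) = b"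
  by (metis inv_closed l_inv l_one m_assoc)

lemma r_inv_cancel: "a \<in> carrier G \<Longrightarrow> b \<in> carrier G \<Longrightarrow> a \<otimes> (inv a \<otimes> b) = b"
  by (metis inv_closed r_inv l_one m_assoc)

lemma eval_word_closed:
  assumes "range f \<subseteq> carrier G"
  shows "eval_word G f w \<in> carrier G"
proof -
  have "f a \<in> carrier G" for a using assms by blast
  then show ?thesis by (induction w) (auto simp: eval_word_def)
qed

lemma eval_word_Cons:
  "eval_word G f ((a, b) # w) = (if b then f a else inv (f a)) \<otimes> eval_word G f w"
  by (simp add: eval_word_def)

lemma eval_word_append:
  assumes "range f \<subseteq> carrier G"
  shows "eval_word G f (u @ v) = eval_word G f u \<otimes> eval_word G f v"
proof (induction u)
  case (Cons p u)
  have f: "f a \<in> carrier G" for a using assms by blast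
  show ?case
    using Cons by (cases p) (simp add: eval_word_Cons eval_word_closed[OF assms] f m_assoc)
qed (simp add: eval_word_closed[OF assms], simp add: eval_word_def)

lemma eval_word_cancel_step:
  assumes "range f \<subseteq> carrier G" "cancel_step u v"
  shows "eval_word G f u = eval_word G f v"
  using assms(2)
proof cases
  case (1 u' a b v')
  have f: "f a \<in> carrier G" for a using assms by blast
  show ?thesis
    unfolding 1
    by (simp add: eval_word_append[OF assms(1)] eval_word_Cons f eval_word_closed[OF assms(1)]
        l_inv_cancel r_inv_cancel)
qed

lemma eval_word_free_eq:
  assumes "range f \<subseteq> carrier G" "(u, v) \<in> free_eq"
  shows "eval_word G f u = eval_word G f v"
proof -
  have "equivclp cancel_step u v" using assms(2) by (simp add: free_eq_def)
  then show ?thesis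
    by (induction rule: equivclp_induct) (auto dest: eval_word_cancel_step[OF assms(1)])
qed

lemma free_group_universal:
  assumes "range f \<subseteq> carrier G"
  obtains h where "h \<in> hom free_group G" "\<And>a. h (free_gen a) = f a"
proof
  define h where "h A = eval_word G f (SOME u. u \<in> A)" for A
  have h: "h (free_eq `` {u}) = eval_word G f u" for u
  proof -
    have "u \<in> free_eq `` {u}" using equiv_class_self[OF equiv_free_eq] by auto
    then have "(SOME v. v \<in> free_eq `` {u}) \<in> free_eq `` {u}" by (rule someI)
    then show ?thesis
      unfolding h_def using eval_word_free_eq[OF assms] by (metis Image_singleton_iff)
  qed
  show "h \<in> hom free_group G"
    by (rule homI)
      (auto simp: carrier_free_group h mult_free_group eval_word_append[OF assms]
        eval_word_closed[OF assms])
  show "h (free_gen a) = f a" for a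
    using assms by (simp add: free_gen_def h eval_word_Cons) (simp add: eval_word_def image_subset_iff)
qed

lemma normal_closure_normal:
  assumes "S \<subseteq> carrier G"
  shows "normal_closure G S \<lhd> G"
proof -
  \<comment> \<open>The family must be nonempty: the intersection of the empty family would be
    \<open>UNIV\<close>.\<close>
  have "carrier G \<lhd> G" using normal_inv_iff subgroup_self by auto
  with assms have ne: "{N. N \<lhd> G \<and> S \<subseteq> N} \<noteq> {}" by auto
  have "subgroup (normal_closure G S) G"
    unfolding normal_closure_def
    by (rule subgroups_Inter[OF _ ne]) (auto simp: normal_inv_iff)
  then show ?thesis
    by (auto simp: normal_inv_iff) (auto simp: normal_closure_def normal_inv_iff)
qed

end

lemma normal_closure_subset: "S \<subseteq> normal_closure G S"
  by (auto simp: normal_closure_def)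

lemma normal_closure_minimal: "N \<lhd> G \<Longrightarrow> S \<subseteq> N \<Longrightarrow> normal_closure G S \<subseteq> N"
  by (auto simp: normal_closure_def)

section \<open>Groups given by generators and relations\<close>

locale presentation =
  fixes R :: "('a word set \<times> 'a word set) set"
  assumes R_closed: "R \<subseteq> carrier free_group \<times> carrier free_group"
begin

sublocale free: group free_group by (rule group_free_group)

sublocale relators: normal "relator_closure R" free_group
  unfolding relator_closure_def
  by (rule free.normal_closure_normal) (use R_closed in blast)

lemma group_presented_group: "group (presented_group R)"
  unfolding presented_group_def by (rule relators.factorgroup_is_group)

lemma proj_hom: "(\<lambda>u. relator_closure R #>\<^bsub>free_group\<^esub> u) \<in> hom free_group (presented_group R)"
  unfolding presented_group_def by (rule relators.r_coset_hom_Mod)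

sublocale proj: group_hom free_group "presented_group R" "\<lambda>u. relator_closure R #>\<^bsub>free_group\<^esub> u"
  using group_presented_group proj_hom
  by (simp add: group_hom_def group_hom_axioms_def group_free_group)

lemma relation_holds:
  assumes "(u, v) \<in> R"
  shows "relator_closure R #>\<^bsub>free_group\<^esub> u = relator_closure R #>\<^bsub>free_group\<^esub> v"
proof -
  have uv: "u \<in> carrier free_group" "v \<in> carrier free_group" using assms R_closed by auto
  have "u \<otimes>\<^bsub>free_group\<^esub> inv\<^bsub>free_group\<^esub> v \<in> relator_closure R"
    unfolding relator_closure_def
    by (rule subsetD[OF normal_closure_subset]) (use assms in auto)
  then have "u \<in> relator_closure R #>\<^bsub>free_group\<^esub> v"
    using uv by (auto simp: r_coset_def free.m_assoc intro!: bexI)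
  then show ?thesis
    using free.repr_independence[OF _ uv(2) relators.subgroup_axioms] by simp
qed

lemma generate_presented_group:
  "generate (presented_group R) (range (presented_gen R)) = carrier (presented_group R)"
proof -
  have "range (presented_gen R) = (\<lambda>u. relator_closure R #>\<^bsub>free_group\<^esub> u) ` range free_gen"
    by (auto simp: presented_gen_def)
  moreover have "range free_gen \<subseteq> carrier free_group" by (auto simp: free_gen_closed)
  ultimately show ?thesis
    using proj.generate_img[of "range free_gen"]
    by (simp add: generate_free_group presented_group_def carrier_FactGroup)
qed

lemma presented_group_universal:
  assumes "group K" "h \<in> hom free_group K" "\<And>u v. (u, v) \<in> R \<Longrightarrow> h u = h v"
  obtains F where "F \<in> hom (presented_group R) K" "\<And>a. F (presented_gen R a) = h (free_gen a)"
proof -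
  interpret K: group K by fact
  interpret h: group_hom free_group K h
    using assms(2) by unfold_locales
  have "relator_closure R \<subseteq> kernel free_group K h"
    unfolding relator_closure_def
  proof (rule normal_closure_minimal[OF h.normal_kernel])
    show "{u \<otimes>\<^bsub>free_group\<^esub> inv\<^bsub>free_group\<^esub> v |u v. (u, v) \<in> R} \<subseteq> kernel free_group K h"
      using R_closed assms(3) by (fastforce simp: kernel_def)
  qed
  then have *: "h u = h v"
    if "u \<in> carrier free_group" "v \<in> carrier free_group"
      "relator_closure R #>\<^bsub>free_group\<^esub> u = relator_closure R #>\<^bsub>free_group\<^esub> v" for u v
  proof -
    have "u \<in> relator_closure R #>\<^bsub>free_group\<^esub> v"
      using free.rcos_self relators.subgroup_axioms that by metis
    then obtain n where "n \<in> relator_closure R" "u = n \<otimes>\<^bsub>free_group\<^esub> v"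
      by (auto simp: r_coset_def)
    moreover from this have "n \<in> carrier free_group" "h n = \<one>\<^bsub>K\<^esub>"
      using \<open>relator_closure R \<subseteq> _\<close> by (auto simp: kernel_def)
    ultimately show ?thesis using that by simp
  qed
  obtain F where "F \<in> hom (free_group Mod relator_closure R) K"
      "\<And>u. u \<in> carrier free_group \<Longrightarrow> F (relator_closure R #>\<^bsub>free_group\<^esub> u) = h u"
    using FactGroup_universal[OF assms(2) relators.normal_axioms *] by blast
  then show thesis
    by (intro that[of F]) (auto simp: presented_group_def presented_gen_def free_gen_closed)
qed

end


section \<open>A permutation representation of the Baumslag-Gersten group\<close>

type_synonym aff = "rat \<times> int"

text \<open>The pair \<open>(q, n)\<close> stands for the affine map \<open>v \<mapsto> q + v / 2^n\<close>.\<close>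

definition aff_mult :: "aff \<Rightarrow> aff \<Rightarrow> aff" (infixl \<open>\<bullet>\<close> 70) where
  "b \<bullet> c = (fst b + fst c * 2 powi (- snd b), snd b + snd c)"

text \<open>Passing \<open>t\<close> (for \<open>e = True\<close>) or its inverse from left to right across a power of \<open>y\<close>,
  respectively \<open>x\<close>, applies \<open>pass e\<close>; \<open>rep e\<close> picks representatives of the right cosets of the
  subgroup generated by \<open>y\<close>, respectively \<open>x\<close>.\<close>

fun pass :: "bool \<Rightarrow> aff \<Rightarrow> aff" where
  "pass True (q, n) = (of_int n, 0)"
| "pass False (q, n) = (0, \<lfloor>q\<rfloor>)"

fun rep :: "bool \<Rightarrow> aff \<Rightarrow> aff" where
  "rep True (q, n) = (q * 2 powi n, 0)"
| "rep False (q, n) = (frac q, n)"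

lemma aff_assoc: "a \<bullet> b \<bullet> c = a \<bullet> (b \<bullet> c)"
  by (simp add: aff_mult_def algebra_simps power_int_add flip: power_int_minus)
    (simp add: power_int_diff power_int_minus field_simps)

lemma aff_one [simp]: "(0, 0) \<bullet> b = b" "b \<bullet> (0, 0) = b"
  by (simp_all add: aff_mult_def)

definition aff_inv :: "aff \<Rightarrow> aff" where
  "aff_inv b = (- fst b * 2 powi snd b, - snd b)"

lemma aff_inv [simp]: "aff_inv b \<bullet> b = (0, 0)" "b \<bullet> aff_inv b = (0, 0)"
  by (simp_all add: aff_mult_def aff_inv_def power_int_minus)

text \<open>\<open>pass (\<not> e)\<close> inverts \<open>pass e\<close> on the associated
  subgroups, so \<open>pass (\<not> e) (pass e b)\<close> is the subgroup factor of \<open>b\<close>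
  along its right coset.\<close>

lemma pass_rep: "pass (\<not> e) (pass e b) \<bullet> rep e b = b"
  by (cases e; cases b) (auto simp: aff_mult_def power_int_minus frac_def)

lemma rep_rep [simp]: "rep e (rep e b) = rep e b"
  by (cases e; cases b) auto

text \<open>\<open>pass e b\<close> lies in the subgroup whose right cosets
  \<open>rep (\<not> e)\<close> represents.\<close>

lemma rep_pass_mult: "rep (\<not> e) (pass e b \<bullet> c) = rep (\<not> e) c"
  by (cases e; cases b; cases c) (auto simp: aff_mult_def power_int_add power_int_minus frac_def)

lemma pass_pass_mult:
  "rep (\<not> e) r = r \<Longrightarrow> pass (\<not> e) (pass e b \<bullet> r) = pass (\<not> e) (pass e b)"
  by (cases e; cases b; cases r) (auto simp: aff_mult_def frac_eq floor_eq_iff)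

text \<open>\<open>rep e b = (0, 0)\<close> serves from here on as the test for \<open>b\<close>
  being a power of y (\<open>True\<close>: the map fixes 0) or of x (\<open>False\<close>: an
  integral translation).\<close>

lemma rep_eq_one_iff:
  "rep True b = (0, 0) \<longleftrightarrow> fst b = 0" "rep False b = (0, 0) \<longleftrightarrow> fst b \<in> \<int> \<and> snd b = 0"
  by (cases b; auto simp: frac_eq_0_iff)+

lemma rep_pass [simp]: "rep (\<not> e) (pass e b) = (0, 0)"
  by (cases e; cases b) (auto simp: frac_def)

text \<open>\<open>rep\<close> itself is invariant only under left factors from the subgroup;
  membership is also invariant under right factors.\<close>

lemma rep_mult_eq_one: "rep e c = (0, 0) \<Longrightarrow> rep e (b \<bullet> c) = (0, 0) \<longleftrightarrow> rep e b = (0, 0)"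
proof -
  assume c: "rep e c = (0, 0)"
  have *: "p + q \<in> \<int> \<longleftrightarrow> p \<in> \<int>" if "q \<in> \<int>" for p q :: rat
    using that by (metis Ints_add Ints_diff add_diff_cancel_right')
  show ?thesis
  proof (cases e)
    case False
    then have "fst c \<in> \<int>" "snd c = 0" using c by (auto simp: rep_eq_one_iff)
    then show ?thesis using False *[of "fst c" "fst b"] by (auto simp: rep_eq_one_iff aff_mult_def)
  qed (use c in \<open>simp add: rep_eq_one_iff aff_mult_def\<close>)
qed

section \<open>Normal forms and the permutations of them\<close>

type_synonym nf = "aff \<times> (bool \<times> aff) list"

text \<open>\<open>(b, [(e1, r1), \<dots>, (en, rn)])\<close> is the normal form of \<open>b t^e1 r1 \<dots> t^en rn\<close>.\<close>

definition nfs :: "nf set" where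
  "nfs = {(b, L). (\<forall>(e, r)\<in>set L. rep e r = r) \<and>
    successively (\<lambda>(e, r) (e', r'). r = (0, 0) \<longrightarrow> e' = e) L}"

text \<open>Left multiplication by t^e. The subgroup factor of \<open>b\<close> crosses the letter
  and becomes \<open>pass e b\<close>; the first branch of the \<open>if\<close> is the case where
  the letter then meets its inverse with nothing in between.\<close>

fun nf_step :: "bool \<Rightarrow> nf \<Rightarrow> nf" where
  "nf_step e (b, []) = (pass e b, [(e, rep e b)])"
| "nf_step e (b, (e', r) # L) =
    (if e' = (\<not> e) \<and> rep e b = (0, 0) then (pass e b \<bullet> r, L)
     else (pass e b, (e, rep e b) # (e', r) # L))"

lemma nfs_mult [simp]: "(b \<bullet> c, L) \<in> nfs \<longleftrightarrow> (c, L) \<in> nfs"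
  by (simp add: nfs_def)

lemma nfs_Nil [simp]: "(b, []) \<in> nfs"
  by (simp add: nfs_def)

lemma nf_step_closed: "s \<in> nfs \<Longrightarrow> nf_step e s \<in> nfs"
  by (cases "(e, s)" rule: nf_step.cases)
    (auto simp: nfs_def successively_Cons split: prod.splits)

lemma nf_step_inverse:
  assumes "s \<in> nfs"
  shows "nf_step (\<not> e) (nf_step e s) = s"
proof (cases "(e, s)" rule: nf_step.cases)
  case (1 e b)
  then show ?thesis using pass_rep[of e b] by simp
next
  case (2 e b e' r L)
  show ?thesis
  proof (cases "e' = (\<not> e) \<and> rep e b = (0, 0)")
    case True
    have r: "rep (\<not> e) r = r" using assms 2 True by (auto simp: nfs_def)
    have b: "pass (\<not> e) (pass e b) = b" using pass_rep[of e b] True by simp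
    show ?thesis
    proof (cases L)
      case Nil
      then show ?thesis using 2 True r b by (simp add: rep_pass_mult pass_pass_mult)
    next
      case (Cons p L')
      obtain e2 r2 where p: "p = (e2, r2)" by (cases p)
      \<comment> \<open>The letter put back after the cancellation must not cancel against the next
        one; the neighbour condition in \<open>nfs\<close> says exactly this.\<close>
      have "r = (0, 0) \<longrightarrow> e2 = (\<not> e)"
        using assms 2 True Cons p by (auto simp: nfs_def successively_Cons)
      then show ?thesis using 2 True Cons p r b by (auto simp: rep_pass_mult pass_pass_mult)
    qed
  next
    case False
    \<comment> \<open>Nothing cancelled, and \<open>pass e b\<close> lies in the subgroup for
      \<open>\<not> e\<close>, so the second step removes the letter just added.\<close>
    then show ?thesis using 2 pass_rep[of e b] by auto
  qed
qed

text \<open>The relation t y = x t on normal forms: a left factor y leaves the coset representative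
  alone and becomes x under \<open>pass True\<close>.\<close>

lemma nf_step_relation:
  "nf_step True ((0, 1) \<bullet> b, L) = (let (c, M) = nf_step True (b, L) in ((1, 0) \<bullet> c, M))"
proof -
  obtain q n where b: "b = (q, n)" by force
  have rep: "rep True ((0, 1) \<bullet> b) = rep True b"
    by (simp add: b aff_mult_def power_int_add power_int_minus)
  have pass: "pass True ((0, 1) \<bullet> b) = (1, 0) \<bullet> pass True b"
    by (simp add: b aff_mult_def)
  show ?thesis
  proof (cases L)
    case (Cons p L')
    then show ?thesis by (cases p) (simp add: rep pass aff_assoc)
  qed (simp add: rep pass)
qed

text \<open>Restricted to \<open>nfs\<close> because the members of \<open>Bij\<close> are
  extensional.\<close>

definition left_mult :: "aff \<Rightarrow> nf \<Rightarrow> nf" where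
  "left_mult b = (\<lambda>(c, L)\<in>nfs. (b \<bullet> c, L))"

definition stable_letter :: "bool \<Rightarrow> nf \<Rightarrow> nf" where
  "stable_letter e = restrict (nf_step e) nfs"

lemma left_mult_Bij: "left_mult b \<in> Bij nfs"
proof -
  have "bij_betw (\<lambda>(c, L). (b \<bullet> c, L)) nfs nfs"
    by (rule bij_betw_byWitness[where f' = "\<lambda>(c, L). (aff_inv b \<bullet> c, L)"])
      (auto simp flip: aff_assoc)
  then show ?thesis by (simp add: left_mult_def Bij_def)
qed

lemma stable_letter_Bij: "stable_letter e \<in> Bij nfs"
proof -
  have "bij_betw (nf_step e) nfs nfs"
    by (rule bij_betw_byWitness[where f' = "nf_step (\<not> e)"])
      (use nf_step_inverse[of _ e] nf_step_inverse[of _ "\<not> e"] nf_step_closed in auto)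
  then show ?thesis by (simp add: stable_letter_def Bij_def)
qed

section \<open>The Baumslag-Gersten group and its action on normal forms\<close>

lemma conj_by_eqI:
  assumes "group K" "a \<in> carrier K" "b \<in> carrier K" "c \<in> carrier K" "a \<otimes>\<^bsub>K\<^esub> b = b \<otimes>\<^bsub>K\<^esub> c"
  shows "conj_by K a b = c"
proof -
  interpret group K by fact
  show ?thesis using assms by (simp add: conj_by_def m_assoc inv_solve_left')
qed

lemma BG_presentation: "presentation BG_rels"
proof
  interpret group "free_group :: gen word set monoid" by (rule group_free_group)
  show "BG_rels \<subseteq> carrier free_group \<times> carrier free_group"
    by (auto simp: BG_rels_def conj_by_def free_gen_closed)
qed

interpretation BG_pres: presentation BG_rels by (rule BG_presentation)

lemma hom_conj_by:
  assumes "group_hom G K h" "a \<in> carrier G" "b \<in> carrier G"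
  shows "h (conj_by G a b) = conj_by K (h a) (h b)"
proof -
  interpret group_hom G K h by fact
  show ?thesis using assms by (simp add: conj_by_def)
qed

text \<open>Used twice: with a permutation group as target it yields the action on normal forms,
  with \<open>BG\<close> itself the maps F_g.\<close>

lemma BG_universal:
  assumes "group K" "a \<in> carrier K" "b \<in> carrier K" "c \<in> carrier K"
    and "conj_by K a b = a \<otimes>\<^bsub>K\<^esub> a" "conj_by K a c = b"
  obtains F where "F \<in> hom BG K" "F BG_x = a" "F BG_y = b" "F BG_t = c"
proof -
  interpret K: group K by fact
  define f where "f g = (case g of Gx \<Rightarrow> a | Gy \<Rightarrow> b | Gt \<Rightarrow> c)" for g
  have "range f \<subseteq> carrier K" using assms by (auto simp: f_def split: gen.split)
  then obtain h where h: "h \<in> hom free_group K" "\<And>g. h (free_gen g) = f g"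
    using K.free_group_universal by blast
  interpret h: group_hom free_group K h using h(1) by unfold_locales
  have "h u = h v" if "(u, v) \<in> BG_rels" for u v
  proof -
    have "h (conj_by free_group (free_gen g) (free_gen g')) = conj_by K (f g) (f g')" for g g'
      by (simp add: hom_conj_by[OF h.group_hom_axioms] free_gen_closed h)
    then show ?thesis
      using that assms(5,6) by (auto simp: BG_rels_def h(2) f_def numeral_2_eq_2 free_gen_closed)
  qed
  with BG_pres.presented_group_universal[OF assms(1) h(1)]
  obtain F where "F \<in> hom (presented_group BG_rels) K"
    "\<And>g. F (presented_gen BG_rels g) = h (free_gen g)" by blast
  then show thesis
    by (intro that[of F]) (simp_all add: BG_def BG_x_def BG_y_def BG_t_def h f_def)
qed

lemma group_BG: "group BG"
  unfolding BG_def by (rule BG_pres.group_presented_group)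

lemma BG_gens_closed: "BG_x \<in> carrier BG" "BG_y \<in> carrier BG" "BG_t \<in> carrier BG"
  using BG_pres.proj.hom_closed[OF free_gen_closed]
  by (simp_all add: BG_def BG_x_def BG_y_def BG_t_def presented_gen_def)

lemma BG_relations: "conj_by BG BG_x BG_y = BG_x \<otimes>\<^bsub>BG\<^esub> BG_x" "conj_by BG BG_x BG_t = BG_y"
proof -
  note conjugate = hom_conj_by[OF BG_pres.proj.group_hom_axioms free_gen_closed free_gen_closed]
  have "(conj_by free_group (free_gen Gx) (free_gen Gy), free_gen Gx [^]\<^bsub>free_group\<^esub> (2::nat)) \<in> BG_rels"
    by (simp add: BG_rels_def)
  from BG_pres.relation_holds[OF this] show "conj_by BG BG_x BG_y = BG_x \<otimes>\<^bsub>BG\<^esub> BG_x"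
    by (simp add: conjugate BG_def BG_x_def BG_y_def presented_gen_def free_gen_closed numeral_2_eq_2)
  have "(conj_by free_group (free_gen Gx) (free_gen Gt), free_gen Gy) \<in> BG_rels"
    by (simp add: BG_rels_def)
  from BG_pres.relation_holds[OF this] show "conj_by BG BG_x BG_t = BG_y"
    by (simp add: conjugate BG_def BG_x_def BG_y_def BG_t_def presented_gen_def)
qed

lemma BG_generate: "generate BG {BG_x, BG_y, BG_t} = carrier BG"
proof -
  have "UNIV = {Gx, Gy, Gt}" using gen.exhaust by auto
  then have "range (presented_gen BG_rels) = presented_gen BG_rels ` {Gx, Gy, Gt}"
    by (rule arg_cong)
  then have "range (presented_gen BG_rels) = {BG_x, BG_y, BG_t}"
    by (simp add: BG_x_def BG_y_def BG_t_def)
  then show ?thesis using BG_pres.generate_presented_group by (simp add: BG_def)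
qed

lemma BG_action:
  obtains act where "act \<in> hom BG (BijGroup nfs)"
    "act BG_x = left_mult (1, 0)" "act BG_y = left_mult (0, 1)" "act BG_t = stable_letter True"
proof -
  have carr: "left_mult b \<in> carrier (BijGroup nfs)" "stable_letter e \<in> carrier (BijGroup nfs)" for b e
    by (simp_all add: BijGroup_def left_mult_Bij stable_letter_Bij)
  have lm: "left_mult b \<otimes>\<^bsub>BijGroup nfs\<^esub> left_mult c = left_mult (b \<bullet> c)" for b c
    by (auto simp: BijGroup_def left_mult_Bij compose_def fun_eq_iff aff_assoc)
      (auto simp: left_mult_def aff_assoc)
  have "conj_by (BijGroup nfs) (left_mult (1, 0)) (left_mult (0, 1)) =
      left_mult (1, 0) \<otimes>\<^bsub>BijGroup nfs\<^esub> left_mult (1, 0)"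
    by (rule conj_by_eqI[OF group_BijGroup]) (simp_all add: carr lm, simp add: aff_mult_def power_int_minus)
  moreover have "conj_by (BijGroup nfs) (left_mult (1, 0)) (stable_letter True) = left_mult (0, 1)"
  proof (rule conj_by_eqI[OF group_BijGroup])
    show "left_mult (1, 0) \<otimes>\<^bsub>BijGroup nfs\<^esub> stable_letter True =
        stable_letter True \<otimes>\<^bsub>BijGroup nfs\<^esub> left_mult (0, 1)"
      using nf_step_closed
      by (auto simp: BijGroup_def left_mult_Bij stable_letter_Bij compose_def fun_eq_iff)
        (auto simp: left_mult_def stable_letter_def nf_step_relation Let_def split: prod.splits)
  qed (simp_all add: carr)
  ultimately show thesis
    using BG_universal[OF group_BijGroup carr(1) carr(1) carr(2)] that by metis
qed


section \<open>Britton's lemma\<close>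

context group
begin

lemma nat_pow_intertwine:
  assumes "a \<in> carrier G" "b \<in> carrier G" "c \<in> carrier G" "a \<otimes> b = b \<otimes> c"
  shows "a [^] (n::nat) \<otimes> b = b \<otimes> c [^] n"
proof (induction n)
  case (Suc n)
  have "a [^] Suc n \<otimes> b = a [^] n \<otimes> (a \<otimes> b)" using assms by (simp add: m_assoc)
  also have "\<dots> = (a [^] n \<otimes> b) \<otimes> c" using assms by (simp add: m_assoc)
  finally show ?case using assms by (simp add: Suc m_assoc)
qed (use assms in simp)

lemma int_pow_intertwine:
  assumes "a \<in> carrier G" "b \<in> carrier G" "c \<in> carrier G" "a \<otimes> b = b \<otimes> c"
  shows "a [^] (m::int) \<otimes> b = b \<otimes> c [^] m"
proof (cases m rule: int_cases2)
  case (nonneg n)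
  then show ?thesis using nat_pow_intertwine[OF assms] by (simp add: int_pow_int)
next
  case (nonpos n)
  have "a [^] n \<otimes> (b \<otimes> inv (c [^] n)) = b"
    using nat_pow_intertwine[OF assms, of n] assms by (simp flip: m_assoc) (simp add: m_assoc)
  then have "b \<otimes> inv (c [^] n) = inv (a [^] n) \<otimes> b"
    using assms by (simp add: inv_solve_left)
  then show ?thesis using nonpos assms by (simp add: int_pow_neg_int)
qed

end

text \<open>The structure theory below sees the presentation only through these facts. The relations
  are written without inverses, the shape that \<open>int_pow_intertwine\<close> raises to
  powers.\<close>

locale gersten_action = group G for G (structure) +
  fixes x y t :: 'a and act :: "'a \<Rightarrow> nf \<Rightarrow> nf"
  assumes gens [simp]: "x \<in> carrier G" "y \<in> carrier G" "t \<in> carrier G"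
    and rel_xy: "x \<otimes> y = y \<otimes> (x \<otimes> x)" and rel_xt: "x \<otimes> t = t \<otimes> y"
    and generates: "generate G {x, y, t} = carrier G"
    and act_closed: "g \<in> carrier G \<Longrightarrow> s \<in> nfs \<Longrightarrow> act g s \<in> nfs"
    and act_one: "s \<in> nfs \<Longrightarrow> act \<one> s = s"
    and act_mult: "g \<in> carrier G \<Longrightarrow> h \<in> carrier G \<Longrightarrow> s \<in> nfs \<Longrightarrow> act (g \<otimes> h) s = act g (act h s)"
    and act_x: "(b, L) \<in> nfs \<Longrightarrow> act x (b, L) = ((1, 0) \<bullet> b, L)"
    and act_y: "(b, L) \<in> nfs \<Longrightarrow> act y (b, L) = ((0, 1) \<bullet> b, L)"
    and act_t: "s \<in> nfs \<Longrightarrow> act t s = nf_step True s"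
begin

section \<open>The subgroup H as a group of affine maps\<close>

definition H :: "'a set" where "H = generate G {x, y}"

text \<open>Intended for elements of H: these act by a left multiplication on the first component
  (\<open>act_H\<close>), which the image of one normal form determines.\<close>

definition aff :: "'a \<Rightarrow> aff" where "aff h = fst (act h ((0, 0), []))"

lemma subgroup_H: "subgroup H G"
  unfolding H_def by (rule generate_is_subgroup) simp

lemmas H_mult [simp] = subgroup.m_closed[OF subgroup_H]
lemmas H_inv [simp] = subgroup.m_inv_closed[OF subgroup_H]
lemmas H_one [simp] = subgroup.one_closed[OF subgroup_H]
lemmas H_carrier [simp] = subgroup.mem_carrier[OF subgroup_H]

lemma H_gens [simp]: "x \<in> H" "y \<in> H"
  by (auto simp: H_def intro: generate.incl)

lemma H_nat_pow [simp]: "h \<in> H \<Longrightarrow> h [^] (n::nat) \<in> H"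
  by (induction n) auto

lemma H_int_pow [simp]: "h \<in> H \<Longrightarrow> h [^] (n::int) \<in> H"
  by (cases n rule: int_cases2) (simp_all add: int_pow_int int_pow_neg_int)

lemma act_inv:
  assumes "g \<in> carrier G" "s \<in> nfs"
  shows "act (inv g) (act g s) = s"
  using act_mult[of "inv g" g s] assms by (simp add: act_one)

lemma act_inv_gen:
  assumes "g \<in> {x, y}" "(b, L) \<in> nfs"
  shows "act (inv g) (b, L) = (aff_inv (if g = x then (1, 0) else (0, 1)) \<bullet> b, L)"
proof -
  let ?c = "if g = x then (1, 0) else (0, 1)"
  have *: "(aff_inv ?c \<bullet> b, L) \<in> nfs" using assms(2) by simp
  have "act g (aff_inv ?c \<bullet> b, L) = (b, L)"
    using assms(1) act_x[OF *] act_y[OF *] by (auto simp flip: aff_assoc)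
  then show ?thesis using act_inv[OF _ *, of g] assms(1) by auto
qed

lemma act_H_ex:
  assumes "h \<in> H"
  shows "\<exists>c. \<forall>b L. (b, L) \<in> nfs \<longrightarrow> act h (b, L) = (c \<bullet> b, L)"
  using assms unfolding H_def
proof (induction rule: generate.induct)
  case one
  then show ?case by (intro exI[of _ "(0, 0)"]) (simp add: act_one)
next
  case (incl h)
  then show ?case using act_x act_y by auto
next
  case (inv h)
  then show ?case using act_inv_gen by blast
next
  case (eng h1 h2)
  then obtain c1 c2 where "\<forall>b L. (b, L) \<in> nfs \<longrightarrow> act h1 (b, L) = (c1 \<bullet> b, L)"
    "\<forall>b L. (b, L) \<in> nfs \<longrightarrow> act h2 (b, L) = (c2 \<bullet> b, L)" by blast
  moreover have "h1 \<in> carrier G" "h2 \<in> carrier G" using eng.hyps H_carrier by (auto simp: H_def)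
  ultimately show ?case
    by (intro exI[of _ "c1 \<bullet> c2"]) (simp add: act_mult aff_assoc del: split_paired_All)
qed

lemma act_H:
  assumes "h \<in> H" "(b, L) \<in> nfs"
  shows "act h (b, L) = (aff h \<bullet> b, L)"
proof -
  obtain c where c: "act h (b, L) = (c \<bullet> b, L)" if "(b, L) \<in> nfs" for b L
    using act_H_ex[OF assms(1)] by blast
  from c[of "(0, 0)" "[]"] have "aff h = c" by (simp add: aff_def)
  with c assms(2) show ?thesis by simp
qed

lemma aff_hom [simp]:
  "aff \<one> = (0, 0)" "aff x = (1, 0)" "aff y = (0, 1)"
  "h \<in> H \<Longrightarrow> k \<in> H \<Longrightarrow> aff (h \<otimes> k) = aff h \<bullet> aff k"
proof -
  show "aff (h \<otimes> k) = aff h \<bullet> aff k" if "h \<in> H" "k \<in> H"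
  proof -
    have "act (h \<otimes> k) ((0, 0), []) = act h (act k ((0, 0), []))"
      using that by (intro act_mult) auto
    also have "act k ((0, 0), []) = (aff k, [])"
      using act_H[OF that(2), of "(0, 0)" "[]"] by simp
    also have "act h (aff k, []) = (aff h \<bullet> aff k, [])"
      using act_H[OF that(1), of "aff k" "[]"] by simp
    finally show ?thesis by (simp add: aff_def[of "h \<otimes> k"])
  qed
  show "aff \<one> = (0, 0)" by (simp add: aff_def act_one)
  show "aff x = (1, 0)" by (simp add: aff_def act_x)
  show "aff y = (0, 1)" by (simp add: aff_def act_y)
qed

lemma aff_inv_hom [simp]:
  assumes "h \<in> H"
  shows "aff (inv h) = aff_inv (aff h)"
proof -
  have "aff (inv h) \<bullet> aff h = (0, 0)" using aff_hom(4)[of "inv h" h] assms by simp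
  then have "aff (inv h) \<bullet> (aff h \<bullet> aff_inv (aff h)) = aff_inv (aff h)"
    by (simp only: aff_one flip: aff_assoc)
  then show ?thesis by simp
qed

lemma aff_nat_pow: "aff (x [^] (n::nat)) = (of_nat n, 0)" "aff (y [^] n) = (0, int n)"
  by (induction n) (simp_all, simp_all add: aff_mult_def)

lemma aff_int_pow: "aff (x [^] (m::int)) = (of_int m, 0)" "aff (y [^] m) = (0, m)"
  by (cases m rule: int_cases2;
      simp add: int_pow_int int_pow_neg_int aff_nat_pow; simp add: aff_inv_def)+

lemma x_pow_y: "x [^] (m::int) \<otimes> y = y \<otimes> x [^] (2 * m)"
proof -
  have "x \<otimes> x = x [^] (2::int)"
    using int_pow_mult[of x 1 1] by simp
  then show ?thesis
    using int_pow_intertwine[OF _ _ _ rel_xy, of m] by (simp add: int_pow_pow)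
qed

lemma x_pow_y_pow: "x [^] (m::int) \<otimes> y [^] (j::nat) = y [^] j \<otimes> x [^] (2 ^ j * m)"
proof (induction j)
  case (Suc j)
  have "x [^] m \<otimes> y [^] Suc j = (x [^] m \<otimes> y [^] j) \<otimes> y" by (simp add: m_assoc)
  also have "\<dots> = y [^] j \<otimes> (x [^] (2 ^ j * m) \<otimes> y)" by (simp add: Suc m_assoc)
  finally show ?case by (simp add: x_pow_y m_assoc mult.assoc)
qed simp

lemma x_pow_t: "x [^] (m::int) \<otimes> t = t \<otimes> y [^] m"
  by (rule int_pow_intertwine) (simp_all add: rel_xt)

text \<open>Reading a word in x and y from left to right preserves the shape y^i x^m y^-j: a new x^k
  crosses y^-j with its exponent multiplied by 2^j. The factor y^-j is moved to the other side so
  that both exponents of y are natural numbers.\<close>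

lemma H_normal_form:
  assumes "h \<in> H"
  shows "\<exists>(i::nat) (j::nat) (m::int). h \<otimes> y [^] j = y [^] i \<otimes> x [^] m"
proof -
  define P where "P = {g \<in> carrier G. \<exists>(i::nat) (j::nat) (m::int). g \<otimes> y [^] j = y [^] i \<otimes> x [^] m}"
  have P: "g \<in> P" if "g \<in> carrier G" "g \<otimes> y [^] j = y [^] i \<otimes> x [^] m" for g and i j :: nat and m :: int
    using that by (auto simp: P_def)
  have x_pow: "g \<otimes> x [^] (k::int) \<in> P" if gP: "g \<in> P" for g k
  proof -
    obtain i :: nat and j :: nat and m :: int where g: "g \<in> carrier G" "g \<otimes> y [^] j = y [^] i \<otimes> x [^] m"
      using gP by (auto simp: P_def)
    have "(g \<otimes> x [^] k) \<otimes> y [^] j = (g \<otimes> y [^] j) \<otimes> x [^] (2 ^ j * k)"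
      using g(1) by (simp add: m_assoc x_pow_y_pow)
    also have "\<dots> = y [^] i \<otimes> x [^] (m + 2 ^ j * k)"
      by (simp add: g m_assoc flip: int_pow_mult)
    finally show ?thesis by (rule P[rotated]) (simp add: g(1))
  qed
  have y: "g \<otimes> y \<in> P" if gP: "g \<in> P" for g
  proof -
    obtain i :: nat and j :: nat and m :: int where g: "g \<in> carrier G" "g \<otimes> y [^] j = y [^] i \<otimes> x [^] m"
      using gP by (auto simp: P_def)
    have "(g \<otimes> y) \<otimes> y [^] j = (g \<otimes> y [^] j) \<otimes> y"
      using g(1) nat_pow_comm[of y 1 j] by (simp add: m_assoc)
    also have "\<dots> = y [^] Suc i \<otimes> x [^] (2 * m)"
      by (simp add: g m_assoc x_pow_y)
    finally show ?thesis by (rule P[rotated]) (simp add: g(1))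
  qed
  have y_inv: "g \<otimes> inv y \<in> P" if gP: "g \<in> P" for g
  proof -
    obtain i :: nat and j :: nat and m :: int where g: "g \<in> carrier G" "g \<otimes> y [^] j = y [^] i \<otimes> x [^] m"
      using gP by (auto simp: P_def)
    have "(g \<otimes> inv y) \<otimes> y [^] Suc j = y [^] i \<otimes> x [^] m"
      unfolding nat_pow_Suc2[OF gens(2)] using g by (simp add: m_assoc l_inv_cancel)
    then show ?thesis by (rule P[rotated]) (simp add: g(1))
  qed
  \<comment> \<open>Stated for all \<open>g\<close> in \<open>P\<close>, so that in the product case
    the hypothesis for the second factor applies to \<open>g \<otimes> h1\<close>.\<close>
  have "g \<otimes> h \<in> P" if "g \<in> P" for g
    using assms that unfolding H_def
  proof (induction arbitrary: g rule: generate.induct)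
    case one
    then show ?case by (simp add: P_def)
  next
    case (incl h)
    then show ?case using x_pow[of g 1] y by auto
  next
    case (inv h)
    then show ?case using x_pow[of g "-1"] y_inv by (auto simp: int_pow_neg)
  next
    case (eng h1 h2)
    moreover have "h1 \<in> carrier G" "h2 \<in> carrier G" using eng.hyps H_carrier by (auto simp: H_def)
    moreover have "g \<in> carrier G" using eng by (simp add: P_def)
    ultimately show ?case by (simp flip: m_assoc)
  qed
  moreover have "\<one> \<in> P" by (rule P[of _ 0 0 0]) auto
  ultimately have "\<one> \<otimes> h \<in> P" by blast
  with assms show ?thesis by (simp add: P_def)
qed

text \<open>Faithfulness of the affine representation: applying \<open>aff\<close> to the equation
  of \<open>H_normal_form\<close> compares exponents and leaves i = j, m = 0.\<close>

lemma aff_eq_one: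
  assumes "h \<in> H" "aff h = (0, 0)"
  shows "h = \<one>"
proof -
  obtain i j :: nat and m :: int where h: "h \<otimes> y [^] j = y [^] i \<otimes> x [^] m"
    using H_normal_form[OF assms(1)] by blast
  then have "aff (h \<otimes> y [^] j) = aff (y [^] i \<otimes> x [^] m)" by simp
  with assms have "i = j" "m = 0"
    by (simp_all add: aff_nat_pow aff_int_pow) (simp_all add: aff_mult_def)
  with h assms(1) show ?thesis by simp
qed

lemma aff_inj:
  assumes "h \<in> H" "k \<in> H" "aff h = aff k"
  shows "h = k"
proof -
  have "inv h \<otimes> k = \<one>" by (rule aff_eq_one) (use assms in auto)
  then show ?thesis using assms(1,2) by (simp add: inv_solve_left')
qed

section \<open>Reduced words and their normal forms\<close>

definition stable :: "bool \<Rightarrow> 'a" where "stable e = (if e then t else inv t)"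

lemma stable_closed [simp]: "stable e \<in> carrier G"
  by (simp add: stable_def)

lemma stable_cancel [simp]:
  "stable e \<otimes> stable (\<not> e) = \<one>" "stable (\<not> e) \<otimes> stable e = \<one>"
  "g \<in> carrier G \<Longrightarrow> stable e \<otimes> (stable (\<not> e) \<otimes> g) = g"
  "g \<in> carrier G \<Longrightarrow> stable (\<not> e) \<otimes> (stable e \<otimes> g) = g"
  by (auto simp: stable_def l_inv_cancel r_inv_cancel)

lemma act_stable:
  assumes "s \<in> nfs"
  shows "act (stable e) s = nf_step e s"
proof (cases e)
  case False
  have *: "nf_step False s \<in> nfs" using assms by (rule nf_step_closed)
  have "act t (nf_step False s) = s"
    using act_t[OF *] nf_step_inverse[OF assms, of False] by simp
  then show ?thesis using act_inv[OF _ *, of t] False by (simp add: stable_def)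
qed (simp add: stable_def act_t[OF assms])

text \<open>By \<open>aff_inj\<close> the hypothesis makes \<open>h\<close> an actual power of y or
  x in G, and such powers cross the letter by x t = t y.\<close>

lemma stable_pass:
  assumes "h \<in> H" "rep e (aff h) = (0, 0)"
  obtains k where "k \<in> H" "aff k = pass e (aff h)" "stable e \<otimes> h = k \<otimes> stable e"
proof (cases e)
  case True
  obtain n where n: "aff h = (0, n)"
    using assms(2) True by (cases "aff h") (auto simp: rep_eq_one_iff)
  then have "h = y [^] n" using assms by (intro aff_inj) (auto simp: aff_int_pow)
  then show thesis
    using that[of "x [^] n"] True n by (simp add: stable_def aff_int_pow x_pow_t)
next
  case False
  obtain m where m: "aff h = (of_int m, 0)"
    using assms(2) False by (cases "aff h") (auto simp: rep_eq_one_iff elim!: Ints_cases)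
  then have h: "h = x [^] m" using assms by (intro aff_inj) (auto simp: aff_int_pow)
  have "inv t \<otimes> x [^] m = y [^] m \<otimes> inv t"
    using x_pow_t[of m] by (simp add: inv_solve_left' inv_solve_right flip: m_assoc)
      (simp add: m_assoc l_inv_cancel)
  then show thesis
    using that[of "y [^] m"] False m h by (simp add: stable_def aff_int_pow)
qed

text \<open>The word \<open>[(h1, e1), \<dots>, (hn, en)]\<close> with tail \<open>g\<close> stands for \<open>h1 t^e1 \<dots> hn t^en g\<close>.\<close>

primrec val :: "('a \<times> bool) list \<Rightarrow> 'a \<Rightarrow> 'a" where
  "val [] g = g"
| "val (p # w) g = fst p \<otimes> (stable (snd p) \<otimes> val w g)"

definition H_word :: "('a \<times> bool) list \<Rightarrow> bool" where
  "H_word w \<longleftrightarrow> fst ` set w \<subseteq> H"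

text \<open>\<open>fst q\<close> stands between the letters of \<open>p\<close> and
  \<open>q\<close>, so the condition forbids the pinches t y^n t^-1 and t^-1 x^n t.\<close>

definition reduced :: "('a \<times> bool) list \<Rightarrow> bool" where
  "reduced w \<longleftrightarrow> H_word w \<and>
    successively (\<lambda>p q. snd q = (\<not> snd p) \<longrightarrow> rep (snd p) (aff (fst q)) \<noteq> (0, 0)) w"

lemma H_word_simps [simp]:
  "H_word []" "H_word (p # w) \<longleftrightarrow> fst p \<in> H \<and> H_word w"
  "H_word (u @ v) \<longleftrightarrow> H_word u \<and> H_word v"
  by (auto simp: H_word_def)

lemma reduced_H_word [simp]: "reduced w \<Longrightarrow> H_word w"
  by (simp add: reduced_def)

lemma reduced_Nil [simp]: "reduced []"
  by (simp add: reduced_def)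

lemma reduced_Cons:
  "reduced (p # w) \<longleftrightarrow> fst p \<in> H \<and> reduced w \<and>
    (w \<noteq> [] \<longrightarrow> snd (hd w) = (\<not> snd p) \<longrightarrow> rep (snd p) (aff (fst (hd w))) \<noteq> (0, 0))"
  by (auto simp: reduced_def successively_Cons)

lemma reduced_append:
  "reduced (u @ v) \<longleftrightarrow> reduced u \<and> reduced v \<and>
    (u \<noteq> [] \<longrightarrow> v \<noteq> [] \<longrightarrow> snd (hd v) = (\<not> snd (last u)) \<longrightarrow>
      rep (snd (last u)) (aff (fst (hd v))) \<noteq> (0, 0))"
  by (auto simp: reduced_def successively_append_iff)

lemma val_closed [simp]: "H_word w \<Longrightarrow> g \<in> carrier G \<Longrightarrow> val w g \<in> carrier G"
  by (induction w) auto

lemma val_append: "val (u @ v) g = val u (val v g)"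
  by (induction u) auto

lemma val_tail:
  "H_word w \<Longrightarrow> g \<in> carrier G \<Longrightarrow> k \<in> carrier G \<Longrightarrow> val w g \<otimes> k = val w (g \<otimes> k)"
  by (induction w) (auto simp: m_assoc)

text \<open>No step along a reduced word cancels, so each letter lengthens the normal form by one.
  To see this the induction must also control the leading entry: it is the first coefficient of the
  word up to a right factor in an associated subgroup, an ambiguity that
  \<open>rep_mult_eq_one\<close> makes harmless.\<close>

lemma britton:
  assumes "reduced w" "h \<in> H"
  shows "length (snd (act (val w h) ((0, 0), []))) = length w"
    and "w \<noteq> [] \<Longrightarrow> \<exists>c r L. rep (\<not> snd (hd w)) c = (0, 0) \<and>
      act (val w h) ((0, 0), []) = (aff (fst (hd w)) \<bullet> c, (snd (hd w), r) # L)"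
proof -
  have "length (snd (act (val w h) ((0, 0), []))) = length w \<and>
    (w \<noteq> [] \<longrightarrow> (\<exists>c r L. rep (\<not> snd (hd w)) c = (0, 0) \<and>
      act (val w h) ((0, 0), []) = (aff (fst (hd w)) \<bullet> c, (snd (hd w), r) # L)))"
    using assms
  proof (induction w)
    case Nil
    then show ?case by (simp add: act_H)
  next
    case (Cons p w)
    obtain k e where p: "p = (k, e)" by force
    have red: "k \<in> H" "reduced w" and junction:
      "w \<noteq> [] \<Longrightarrow> snd (hd w) = (\<not> e) \<Longrightarrow> rep e (aff (fst (hd w))) \<noteq> (0, 0)"
      using Cons.prems p by (auto simp: reduced_Cons)
    obtain b L where bL: "act (val w h) ((0, 0), []) = (b, L)"
      by (cases "act (val w h) ((0, 0), [])")
    have IH: "length L = length w"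
      "w \<noteq> [] \<Longrightarrow> \<exists>c r M. rep (\<not> snd (hd w)) c = (0, 0) \<and>
        b = aff (fst (hd w)) \<bullet> c \<and> L = (snd (hd w), r) # M"
      using Cons.IH red Cons.prems bL by auto
    have "(b, L) \<in> nfs"
      using act_closed[of "val w h" "((0, 0), [])"] bL red Cons.prems by simp
    then have "act (val (p # w) h) ((0, 0), []) = act k (nf_step e (b, L))"
      using red Cons.prems by (simp add: p act_mult bL act_stable act_closed)
    moreover have "nf_step e (b, L) = (pass e b, (e, rep e b) # L)"
    proof (cases L)
      case (Cons q M)
      then have "w \<noteq> []" using IH(1) by auto
      then obtain c r M where c: "rep (\<not> snd (hd w)) c = (0, 0)"
        "b = aff (fst (hd w)) \<bullet> c" "L = (snd (hd w), r) # M"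
        using IH(2) by blast
      have "rep e b \<noteq> (0, 0)" if "snd (hd w) = (\<not> e)"
        using junction[OF \<open>w \<noteq> []\<close> that] c(1,2) that by (simp add: rep_mult_eq_one)
      then show ?thesis using c(3) by auto
    qed simp
    moreover have "nf_step e (b, L) \<in> nfs" using \<open>(b, L) \<in> nfs\<close> by (rule nf_step_closed)
    ultimately have "act (val (p # w) h) ((0, 0), []) = (aff k \<bullet> pass e b, (e, rep e b) # L)"
      using red by (simp add: act_H)
    \<comment> \<open>The factor \<open>c\<close> is \<open>pass e b\<close>.\<close>
    then show ?case using IH(1) p by (simp del: split_paired_Ex) (use rep_pass in blast)
  qed
  then show "length (snd (act (val w h) ((0, 0), []))) = length w"
    and "w \<noteq> [] \<Longrightarrow> \<exists>c r L. rep (\<not> snd (hd w)) c = (0, 0) \<and>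
      act (val w h) ((0, 0), []) = (aff (fst (hd w)) \<bullet> c, (snd (hd w), r) # L)"
    by blast+
qed

definition reduced_form :: "'a \<Rightarrow> bool" where
  "reduced_form g \<longleftrightarrow> (\<exists>w h. reduced w \<and> h \<in> H \<and> g = val w h)"

lemma reduced_form_left_H:
  assumes "reduced_form g" "k \<in> H"
  shows "reduced_form (k \<otimes> g)"
proof -
  obtain w h where w: "reduced w" "h \<in> H" "g = val w h"
    using assms(1) by (auto simp: reduced_form_def)
  show ?thesis
  proof (cases w)
    case Nil
    then show ?thesis
      using w assms(2) by (auto simp: reduced_form_def intro!: exI[of _ "[]"])
  next
    case (Cons p w')
    then have "reduced ((k \<otimes> fst p, snd p) # w')" "k \<otimes> g = val ((k \<otimes> fst p, snd p) # w') h"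
      using w assms(2) by (auto simp: reduced_Cons m_assoc)
    then show ?thesis using w(2) unfolding reduced_form_def by blast
  qed
qed

lemma reduced_form_left_stable:
  assumes "reduced_form g"
  shows "reduced_form (stable e \<otimes> g)"
proof -
  obtain w h where w: "reduced w" "h \<in> H" "g = val w h"
    using assms by (auto simp: reduced_form_def)
  show ?thesis
  proof (cases "reduced ((\<one>, e) # w)")
    case True
    moreover have "stable e \<otimes> g = val ((\<one>, e) # w) h" using w by simp
    ultimately show ?thesis using w(2) unfolding reduced_form_def by blast
  next
    case False
    then obtain k w' where w': "w = (k, \<not> e) # w'" "rep e (aff k) = (0, 0)"
      using w(1) by (cases w) (auto simp: reduced_Cons)
    then have k: "k \<in> H" "reduced w'" using w(1) by (auto simp: reduced_Cons)
    obtain k' where k': "k' \<in> H" "stable e \<otimes> k = k' \<otimes> stable e"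
      using stable_pass[OF k(1) w'(2)] by blast
    have "stable e \<otimes> g = (stable e \<otimes> k) \<otimes> (stable (\<not> e) \<otimes> val w' h)"
      using w w' k by (simp add: m_assoc)
    also have "\<dots> = k' \<otimes> val w' h" using k k' w by (simp add: m_assoc)
    moreover have "reduced_form (val w' h)" using k w(2) unfolding reduced_form_def by blast
    ultimately show ?thesis using reduced_form_left_H[OF _ k'(1)] by simp
  qed
qed

lemma reduced_form:
  assumes "g \<in> carrier G"
  obtains w h where "reduced w" "h \<in> H" "g = val w h"
proof -
  have "reduced_form (g \<otimes> k)" if "g \<in> generate G {x, y, t}" "k \<in> carrier G" "reduced_form k" for g k
    using that
  proof (induction arbitrary: k rule: generate.induct)
    case (incl g)
    then show ?case
      using reduced_form_left_H reduced_form_left_stable[of k True] by (auto simp: stable_def)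
  next
    case (inv g)
    then show ?case
      using reduced_form_left_H reduced_form_left_stable[of k False] by (auto simp: stable_def)
  next
    case (eng g1 g2)
    then show ?case by (simp add: generates m_assoc)
  qed simp
  moreover have "reduced_form \<one>"
    by (auto simp: reduced_form_def intro!: exI[of _ "[]"])
  ultimately have "reduced_form (g \<otimes> \<one>)" using assms generates by blast
  with assms that show thesis by (auto simp: reduced_form_def)
qed

end


section \<open>Conjugacy in the Baumslag-Gersten group\<close>

lemma two_powi_eq_one_iff: "2 powi n = (1 :: rat) \<longleftrightarrow> n = 0"
proof (cases n "0 :: int" rule: linorder_cases)
  case less
  then have "1 < (2 :: rat) powi (- n)" by (intro one_less_power_int) auto
  then show ?thesis using less by (auto simp: power_int_minus)
next
  case greater
  then show ?thesis using one_less_power_int[of "2 :: rat" n] by auto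
qed simp

context gersten_action
begin

text \<open>Both sides of \<open>comm\<close> are reduced words: \<open>a\<close> is absorbed into
  the first coefficient, \<open>a'\<close> into the tail. By \<open>britton\<close> the coefficients
  \<open>a \<otimes> k\<close> and \<open>k\<close> agree up to right factors from the associated
  subgroup, so \<open>a0\<close> lies in it and crosses the first letter.\<close>

lemma commute_step:
  assumes "reduced ((k, e) # w)" "h \<in> H" "a \<in> H" "a' \<in> H"
    and comm: "a \<otimes> val ((k, e) # w) h = val ((k, e) # w) h \<otimes> a'"
  defines "a0 \<equiv> inv k \<otimes> a \<otimes> k"
  obtains a1 where "a1 \<in> H" "rep (\<not> e) (aff a0) = (0, 0)" "aff a1 = pass (\<not> e) (aff a0)"
    "stable (\<not> e) \<otimes> a0 = a1 \<otimes> stable (\<not> e)" "a1 \<otimes> val w h = val w h \<otimes> a'"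
proof -
  have k: "k \<in> H" "reduced w" using assms(1) by (auto simp: reduced_Cons)
  have a0: "a0 \<in> H" using assms k by (simp add: a0_def)
  have v: "val w h \<in> carrier G" using k assms(2) by simp
  have "reduced ((a \<otimes> k, e) # w)" using assms(1,3) by (auto simp: reduced_Cons)
  from britton(2)[OF this assms(2)] obtain c r L where c: "rep (\<not> e) c = (0, 0)"
      "act (val ((a \<otimes> k, e) # w) h) ((0, 0), []) = (aff (a \<otimes> k) \<bullet> c, (e, r) # L)"
    by auto
  from britton(2)[OF assms(1) H_mult[OF assms(2,4)]] obtain c' r' L' where c': "rep (\<not> e) c' = (0, 0)"
      "act (val ((k, e) # w) (h \<otimes> a')) ((0, 0), []) = (aff k \<bullet> c', (e, r') # L')"
    by auto
  have "val ((a \<otimes> k, e) # w) h = val ((k, e) # w) (h \<otimes> a')"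
    using comm k assms(2-4) v by (simp add: m_assoc val_tail)
  with c(2) c'(2) have "aff (a \<otimes> k) \<bullet> c = aff k \<bullet> c'" by simp
  moreover have "aff (a \<otimes> k) = aff k \<bullet> aff a0"
    using k assms(3) a0 by (simp add: a0_def m_assoc r_inv_cancel flip: aff_hom(4))
  ultimately have "aff k \<bullet> (aff a0 \<bullet> c) = aff k \<bullet> c'" by (simp add: aff_assoc)
  then have "aff_inv (aff k) \<bullet> (aff k \<bullet> (aff a0 \<bullet> c)) = aff_inv (aff k) \<bullet> (aff k \<bullet> c')" by simp
  then have "aff a0 \<bullet> c = c'" by (simp flip: aff_assoc)
  with c(1) c'(1) have rep: "rep (\<not> e) (aff a0) = (0, 0)"
    using rep_mult_eq_one by metis
  obtain a1 where a1: "a1 \<in> H" "aff a1 = pass (\<not> e) (aff a0)"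
      "stable (\<not> e) \<otimes> a0 = a1 \<otimes> stable (\<not> e)"
    using stable_pass[OF a0 rep] by blast
  have "a0 \<otimes> (stable e \<otimes> val w h) = inv k \<otimes> (a \<otimes> val ((k, e) # w) h)"
    using k assms(3) v by (simp add: a0_def m_assoc)
  also have "\<dots> = inv k \<otimes> (val ((k, e) # w) h \<otimes> a')" by (simp only: comm)
  also have "\<dots> = stable e \<otimes> (val w h \<otimes> a')"
    using k assms(4) v by (simp add: m_assoc l_inv_cancel)
  finally have "stable (\<not> e) \<otimes> (a0 \<otimes> (stable e \<otimes> val w h)) = val w h \<otimes> a'"
    using v assms(4) by simp
  moreover have "stable (\<not> e) \<otimes> (a0 \<otimes> (stable e \<otimes> val w h)) = a1 \<otimes> val w h"
    using a1 a0 v by (simp flip: m_assoc) (simp add: m_assoc)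
  ultimately show thesis using that a1 rep by simp
qed

text \<open>On H, \<open>snd (aff h)\<close> is the exponent sum in y.\<close>

lemma snd_aff_mult: "snd (b \<bullet> c) = snd b + snd c"
  by (simp add: aff_mult_def)

lemma snd_aff_conj: "h \<in> H \<Longrightarrow> a \<in> H \<Longrightarrow> snd (aff (inv h \<otimes> a \<otimes> h)) = snd (aff a)"
  by (simp add: snd_aff_mult aff_inv_def)

text \<open>Moving a nontrivial \<open>a\<close> in the kernel of \<open>H \<rightarrow> \<int>\<close> to the right through a reduced word for \<open>g\<close>
  turns it into a nontrivial power of \<open>y\<close> after one stable letter; this power neither lies in the
  kernel nor passes a second stable letter.\<close>

lemma kernel_conj_in_H:
  assumes "a \<in> H" "a \<noteq> \<one>" "snd (aff a) = 0" "a' \<in> H" "snd (aff a') = 0"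
    and "g \<in> carrier G" "a \<otimes> g = g \<otimes> a'"
  shows "g \<in> H"
proof -
  obtain w h where w: "reduced w" "h \<in> H" "g = val w h"
    using reduced_form[OF assms(6)] by blast
  show ?thesis
  proof (cases w)
    case Nil
    then show ?thesis using w by simp
  next
    case (Cons p w1)
    obtain k e where p: "p = (k, e)" by force
    define a0 where "a0 = inv k \<otimes> a \<otimes> k"
    have k: "k \<in> H" "reduced w1" using w Cons p by (auto simp: reduced_Cons)
    obtain a1 where a1: "a1 \<in> H" "rep (\<not> e) (aff a0) = (0, 0)" "aff a1 = pass (\<not> e) (aff a0)"
      "a1 \<otimes> val w1 h = val w1 h \<otimes> a'"
      using commute_step[of k e w1 h a a'] w Cons p assms unfolding a0_def by metis
    have a0: "a0 \<in> H" "snd (aff a0) = 0"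
      using k assms(1,3) snd_aff_conj by (auto simp: a0_def)
    have "a0 \<noteq> \<one>"
    proof
      assume "a0 = \<one>"
      then have "a \<otimes> k = k" using k assms(1) by (simp add: a0_def m_assoc inv_solve_left')
      then show False using k assms(1,2) by simp
    qed
    with a0 have "fst (aff a0) \<noteq> 0"
      using aff_eq_one by (metis prod.collapse)
    \<comment> \<open>A nontrivial translation is no power of y, so the letter is t and
      \<open>a0\<close> is some x^m; crossing the letter makes it y^m.\<close>
    with a1(2) have e: "e" and "fst (aff a0) \<in> \<int>"
      by (cases e; simp add: rep_eq_one_iff)+
    then obtain m where m: "aff a0 = (of_int m, 0)" "m \<noteq> 0"
      using a0(2) \<open>fst (aff a0) \<noteq> 0\<close> by (cases "aff a0") (auto elim: Ints_cases)
    then have a1': "aff a1 = (0, m)" using a1(3) e by simp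
    show ?thesis
    proof (cases w1)
      case Nil
      then have "snd (aff (a1 \<otimes> h)) = snd (aff (h \<otimes> a'))" using a1(4) by simp
      then show ?thesis using a1(1) a1' w(2) assms(4,5) m(2) by (simp add: snd_aff_mult)
    next
      case (Cons q w2)
      obtain k' e' where q: "q = (k', e')" by force
      have k': "k' \<in> H" using k(2) Cons q by (auto simp: reduced_Cons)
      have rep: "rep (\<not> e') (aff (inv k' \<otimes> a1 \<otimes> k')) = (0, 0)"
        using commute_step[of k' e' w2 h a1 a'] w(2) k a1 Cons q assms(4) by metis
      \<comment> \<open>A conjugate of y^m inside H has exponent sum m \<noteq> 0, so it is no power
        of x.\<close>
      have "e' = False"
        using rep snd_aff_conj[OF k' a1(1)] a1' m(2) by (cases e') (auto simp: rep_eq_one_iff)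
      \<comment> \<open>The conjugate of y^m by \<open>k'\<close> fixes 0, so y^m fixes the image of
        0 under \<open>k'\<close>, which is \<open>fst (aff k')\<close>. But 0 is the only fixed
        point of y^m.\<close>
      moreover have "fst (aff k') = 0"
      proof -
        have "fst (aff (inv k' \<otimes> a1 \<otimes> k')) = 0"
          using rep \<open>e' = False\<close> by (simp add: rep_eq_one_iff)
        moreover have "aff (k' \<otimes> (inv k' \<otimes> a1 \<otimes> k')) = aff (a1 \<otimes> k')"
          using k' a1(1) by (simp add: m_assoc r_inv_cancel)
        ultimately have "fst (aff k') = fst ((0, m) \<bullet> aff k')"
          using k' a1(1) a1' by (subst (asm) (1 2) aff_hom(4)) (auto simp: aff_mult_def)
        then have "fst (aff k') = fst (aff k') * 2 powi - m" by (simp add: aff_mult_def)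
        moreover have "2 powi - m \<noteq> (1 :: rat)"
          using m(2) by (simp add: two_powi_eq_one_iff)
        ultimately show ?thesis by simp
      qed
      \<comment> \<open>The word would begin with k t k' t^-1 where \<open>k'\<close> is a power of
        y: a pinch.\<close>
      ultimately have False
        using w(1) \<open>w = p # w1\<close> Cons p q e by (auto simp: reduced_Cons rep_eq_one_iff)
      then show ?thesis ..
    qed
  qed
qed

text \<open>Commuting with x puts \<open>g\<close> in H. An affine map of this kind that commutes
  with v \<mapsto> v + 1 has slope 1, and one that commutes with v \<mapsto> v / 2 fixes 0.\<close>

lemma centralizer_H_trivial:
  assumes "g \<in> carrier G" "x \<otimes> g = g \<otimes> x" "y \<otimes> g = g \<otimes> y"
  shows "g = \<one>"
proof -
  have "x \<noteq> \<one>" using aff_hom(1,2) by force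
  then have g: "g \<in> H"
    using kernel_conj_in_H[of x x g] assms by simp
  have "(1, 0) \<bullet> aff g = aff g \<bullet> (1, 0)" "(0, 1) \<bullet> aff g = aff g \<bullet> (0, 1)"
    using aff_hom(4) g assms(2,3) H_gens aff_hom(2,3) by metis+
  then have "2 powi - snd (aff g) = (1 :: rat)" "fst (aff g) = 0"
    by (auto simp: aff_mult_def power_int_minus)
  then have "aff g = (0, 0)"
    by (simp add: prod_eq_iff two_powi_eq_one_iff)
  then show ?thesis using aff_eq_one g by simp
qed

section \<open>Growth of the length of normal forms\<close>

lemma length_act_bounded:
  assumes "g \<in> carrier G"
  obtains C where "\<And>s. s \<in> nfs \<Longrightarrow> length (snd (act g s)) \<le> C + length (snd s)"
proof -
  have step: "length (snd (nf_step e s)) \<le> Suc (length (snd s))" for e s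
    by (cases "(e, s)" rule: nf_step.cases) auto
  have H: "snd (act h s) = snd s" if "h \<in> H" "s \<in> nfs" for h s
    using that by (cases s) (simp add: act_H)
  \<comment> \<open>Elements of H do not touch the letters, so the constant is the number of letters
    of \<open>w\<close>. It is uniform in \<open>s\<close>, which lets the bound be iterated over
    powers.\<close>
  have "length (snd (act (val w h) s)) \<le> length w + length (snd s)"
    if "H_word w" "h \<in> H" "s \<in> nfs" for w h s
    using that
  proof (induction w)
    case (Cons p w)
    have "act (val w h) s \<in> nfs" using Cons.prems act_closed by simp
    then have "snd (act (val (p # w) h) s) = snd (nf_step (snd p) (act (val w h) s))"
      using Cons.prems by (simp add: act_mult act_stable act_closed H nf_step_closed)
    also have "length \<dots> \<le> Suc (length (snd (act (val w h) s)))" by (rule step)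
    finally show ?case using Cons by simp
  qed (simp add: H)
  then show thesis using that reduced_form[OF assms] reduced_H_word by metis
qed

lemma length_act_pow:
  assumes "g \<in> carrier G" "\<And>s. s \<in> nfs \<Longrightarrow> length (snd (act g s)) \<le> C + length (snd s)" "s \<in> nfs"
  shows "length (snd (act (g [^] (n::nat)) s)) \<le> n * C + length (snd s)"
  using assms(3)
proof (induction n arbitrary: s)
  case (Suc n)
  have "length (snd (act (g [^] n) (act g s))) \<le> n * C + length (snd (act g s))"
    using Suc act_closed[OF assms(1)] by blast
  with assms(2)[OF Suc.prems] show ?case using assms(1) Suc.prems by (simp add: act_mult)
qed (simp add: act_one)

lemma val_pow:
  assumes "H_word w"
  shows "val w \<one> [^] (n::nat) = val (concat (replicate n w)) \<one>"
proof (induction n)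
  case (Suc n)
  have "H_word (concat (replicate n w))" using assms by (induction n) auto
  then show ?case
    unfolding nat_pow_Suc2[OF val_closed[OF assms one_closed]]
    using assms by (simp add: Suc val_append val_tail)
qed simp

text \<open>Every junction between consecutive copies is the one already present in
  \<open>w @ w\<close>.\<close>

lemma reduced_pow:
  assumes "reduced (w @ w)"
  shows "reduced (concat (replicate n w))"
proof (induction n)
  case (Suc n)
  then show ?case using assms by (cases n) (auto simp: reduced_append)
qed simp

lemma exp_gt_linear: "\<exists>k. k * D + E < (2::nat) ^ k"
proof (intro exI)
  \<comment> \<open>The exponent will be 2 j: then the power of 2 is at least (j + 1)^2, and j is
    large enough for this square to beat the linear term.\<close>
  define j where "j = 2 * D + E"
  have "j + 1 \<le> 2 ^ j" by (metis Suc_eq_plus1 Suc_leI less_exp)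
  then have "(j + 1) * (j + 1) \<le> 2 ^ j * 2 ^ j" by (rule mult_le_mono) fact
  moreover have "2 * j * D + E < (j + 1) * (j + 1)" by (simp add: j_def algebra_simps)
  ultimately show "2 * j * D + E < 2 ^ (2 * j)" by (simp add: mult_2 power_add)
qed

text \<open>Conjugating cyclically reduced words by \<open>b\<close> would give linear growth of the length of
  \<open>a^(2^k)\<close>, which is exponential.\<close>

lemma not_cyclically_reduced:
  assumes "b \<in> carrier G" "reduced (w @ w)" "w \<noteq> []"
    and "val w \<one> \<otimes> b = b \<otimes> (val w \<one> \<otimes> val w \<one>)"
  shows False
proof -
  define a where "a = val w \<one>"
  let ?s = "((0, 0), []) :: nf"
  have w: "H_word w" using assms(2) by (simp add: reduced_append)
  then have a: "a \<in> carrier G" by (simp add: a_def)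
  have ab: "a \<otimes> b = b \<otimes> a [^] (2::nat)"
    using assms(4) a by (simp add: a_def numeral_2_eq_2)
  have pow: "a \<otimes> b [^] k = b [^] k \<otimes> a [^] ((2::nat) ^ k)" for k :: nat
  proof (induction k)
    case (Suc k)
    have "a \<otimes> b [^] Suc k = b [^] k \<otimes> (a [^] ((2::nat) ^ k) \<otimes> b)"
      using a assms(1) by (simp add: m_assoc flip: Suc) (simp add: Suc flip: m_assoc)
    also have "a [^] ((2::nat) ^ k) \<otimes> b = b \<otimes> (a [^] (2::nat)) [^] ((2::nat) ^ k)"
      by (rule nat_pow_intertwine) (use a assms(1) ab in auto)
    finally show ?case using a assms(1) by (simp add: nat_pow_pow m_assoc)
  qed (use a in simp)
  obtain C1 where C1: "\<And>s. s \<in> nfs \<Longrightarrow> length (snd (act b s)) \<le> C1 + length (snd s)"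
    using length_act_bounded[OF assms(1)] by blast
  obtain C2 where C2: "\<And>s. s \<in> nfs \<Longrightarrow> length (snd (act (inv b) s)) \<le> C2 + length (snd s)"
    using length_act_bounded[of "inv b"] assms(1) by auto
  obtain C3 where C3: "\<And>s. s \<in> nfs \<Longrightarrow> length (snd (act a s)) \<le> C3 + length (snd s)"
    using length_act_bounded[OF a] by blast
  have le: "2 ^ k \<le> k * (C1 + C2) + C3" for k
  proof -
    have "reduced (concat (replicate (2 ^ k) w))" using assms(2) by (rule reduced_pow)
    then have "length (snd (act (a [^] ((2::nat) ^ k)) ?s)) = length (concat (replicate (2 ^ k) w))"
      using britton(1)[OF _ H_one] w by (simp add: a_def val_pow)
    also have "\<dots> = 2 ^ k * length w" by (simp add: length_concat sum_list_replicate)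
    finally have "2 ^ k \<le> length (snd (act (a [^] ((2::nat) ^ k)) ?s))"
      using assms(3) by (cases w) auto
    \<comment> \<open>Written as b^-k a b^k, the same element costs C1 + C2 letters per unit of k,
      and C3 once.\<close>
    also have "a [^] ((2::nat) ^ k) = inv b [^] k \<otimes> (a \<otimes> b [^] k)"
      using a assms(1) pow[of k] by (simp add: nat_pow_inv inv_solve_left)
    also have "length (snd (act \<dots> ?s)) \<le> k * C2 + (C3 + (k * C1 + 0))"
    proof -
      let ?s1 = "act (b [^] k) ?s"
      have s1: "?s1 \<in> nfs" using assms(1) act_closed by simp
      have "length (snd ?s1) \<le> k * C1 + 0"
        using length_act_pow[OF assms(1) C1, of ?s k] by simp
      moreover have "length (snd (act a ?s1)) \<le> C3 + length (snd ?s1)" using s1 by (rule C3)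
      moreover have "length (snd (act (inv b [^] k) (act a ?s1))) \<le> k * C2 + length (snd (act a ?s1))"
        by (rule length_act_pow) (use assms(1) C2 act_closed[OF a s1] in auto)
      ultimately show ?thesis using a assms(1) s1 by (simp add: act_mult act_closed)
    qed
    finally show ?thesis by (simp add: algebra_simps)
  qed
  obtain k where "k * (C1 + C2) + C3 < 2 ^ k" using exp_gt_linear by blast
  with le[of k] show False by simp
qed

section \<open>Conjugation into H\<close>

definition conjugate :: "'a \<Rightarrow> 'a \<Rightarrow> 'a" where "conjugate c a = inv c \<otimes> a \<otimes> c"

lemma conjugate_closed [simp]: "c \<in> carrier G \<Longrightarrow> a \<in> carrier G \<Longrightarrow> conjugate c a \<in> carrier G"
  by (simp add: conjugate_def)

lemma conjugate_mult:
  "c \<in> carrier G \<Longrightarrow> a \<in> carrier G \<Longrightarrow> b \<in> carrier G \<Longrightarrow> conjugate c (a \<otimes> b) = conjugate c a \<otimes> conjugate c b"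
  by (simp add: conjugate_def m_assoc r_inv_cancel)

lemma conjugate_conjugate:
  "c \<in> carrier G \<Longrightarrow> d \<in> carrier G \<Longrightarrow> a \<in> carrier G \<Longrightarrow> conjugate d (conjugate c a) = conjugate (c \<otimes> d) a"
  by (simp add: conjugate_def m_assoc inv_mult_group)

text \<open>Induction on the length of a reduced word: if repeating it creates a pinch, a
  conjugation makes its first and last letters cancel and leaves a word two letters shorter.\<close>

lemma elliptic_or_cyclically_reduced:
  assumes "a \<in> carrier G"
  obtains c where "c \<in> carrier G" "conjugate c a \<in> H"
  | c w where "c \<in> carrier G" "conjugate c a = val w \<one>" "w \<noteq> []" "reduced (w @ w)"
proof -
  define Q where "Q a \<longleftrightarrow> (\<exists>c\<in>carrier G. conjugate c a \<in> H \<or>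
    (\<exists>w. conjugate c a = val w \<one> \<and> w \<noteq> [] \<and> reduced (w @ w)))" for a
  have Q_conj: "Q a" if "Q (conjugate c a)" "c \<in> carrier G" "a \<in> carrier G" for a c
    using that conjugate_conjugate m_closed unfolding Q_def by metis
  have "Q (val w h)" if "reduced w" "h \<in> H" for w h
    using that
  proof (induction "length w" arbitrary: w h rule: less_induct)
    case less
    show ?case
    proof (cases w)
      case Nil
      then show ?thesis
        using less.prems by (auto simp: Q_def conjugate_def intro!: bexI[of _ \<one>])
    next
      case (Cons p v)
      obtain k e where p: "p = (k, e)" by force
      have k: "k \<in> H" "reduced v" using less.prems Cons p by (auto simp: reduced_Cons)
      \<comment> \<open>The tail is brought to the front by a conjugation, so that the word can be
        read cyclically.\<close>
      define w' where "w' = (h \<otimes> k, e) # v"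
      have w': "reduced w'" using less.prems Cons p by (auto simp: w'_def reduced_Cons)
      have conjugate: "conjugate (inv h) (val w h) = val w' \<one>"
        using less.prems k by (simp add: Cons p conjugate_def w'_def m_assoc val_tail)
      have "Q (val w' \<one>)"
      proof (cases "reduced (w' @ w')")
        case True
        have "conjugate \<one> (val w' \<one>) = val w' \<one>" using w' by (simp add: conjugate_def)
        then show ?thesis
          unfolding Q_def using True by (intro bexI[of _ \<one>] disjI2 exI[of _ w']) (auto simp: w'_def)
      next
        case False
        moreover have "hd w' = (h \<otimes> k, e)" by (simp add: w'_def)
        ultimately have "snd (last w') = (\<not> e)" and rep: "rep (\<not> e) (aff (h \<otimes> k)) = (0, 0)"
          using w' reduced_append[of w' w'] by auto
        \<comment> \<open>A pinch joins letters of opposite sign, so the first and last letters are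
          distinct.\<close>
        then have "v \<noteq> []" by (auto simp: w'_def)
        then have "last w' = last v" by (simp add: w'_def)
        define u k1 where "u = butlast v" and "k1 = fst (last v)"
        have "last v = (k1, \<not> e)"
          using \<open>last w' = last v\<close> \<open>snd (last w') = (\<not> e)\<close> by (simp add: k1_def prod_eq_iff)
        then have v: "v = u @ [(k1, \<not> e)]"
          using append_butlast_last_id[OF \<open>v \<noteq> []\<close>] by (simp add: u_def)
        then have u: "reduced u" "k1 \<in> H" using k(2) by (auto simp: reduced_append reduced_Cons)
        obtain k2 where k2: "k2 \<in> H" "stable (\<not> e) \<otimes> (h \<otimes> k) = k2 \<otimes> stable (\<not> e)"
          using stable_pass[OF H_mult[OF less.prems(2) k(1)] rep] by blast
        \<comment> \<open>Conjugation by \<open>?c\<close> moves the first letter with its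
          coefficient to the end, where t^-e (h k) t^e collapses to \<open>k2\<close>.\<close>
        let ?c = "(h \<otimes> k) \<otimes> stable e"
        have c: "?c \<in> carrier G" using less.prems(2) k(1) by simp
        have "conjugate ?c (val w' \<one>) = val v \<one> \<otimes> ((h \<otimes> k) \<otimes> stable e)"
          using c less.prems(2) k by (simp add: conjugate_def w'_def m_assoc inv_mult_group l_inv_cancel)
        also have "\<dots> = val u (k1 \<otimes> (stable (\<not> e) \<otimes> ((h \<otimes> k) \<otimes> stable e)))"
          using c u less.prems(2) k by (simp add: v val_append val_tail m_assoc)
        also have "stable (\<not> e) \<otimes> ((h \<otimes> k) \<otimes> stable e) = (stable (\<not> e) \<otimes> (h \<otimes> k)) \<otimes> stable e"
          using less.prems(2) k(1) by (simp add: m_assoc)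
        also have "\<dots> = k2" using k2 by (simp add: m_assoc)
        finally have "conjugate ?c (val w' \<one>) = val u (k1 \<otimes> k2)" .
        moreover have "Q (val u (k1 \<otimes> k2))"
          by (rule less.hyps) (use u k2 in \<open>simp_all add: Cons v\<close>)
        ultimately show ?thesis using Q_conj[OF _ c] w' by simp
      qed
      then show ?thesis
        using Q_conj[of "inv h" "val w h"] conjugate less.prems by simp
    qed
  qed
  then have "Q a" using reduced_form[OF assms] by metis
  then show thesis using that unfolding Q_def by blast
qed

lemma conj_into_H:
  assumes "a \<in> carrier G" "b \<in> carrier G" "a \<otimes> b = b \<otimes> (a \<otimes> a)"
  obtains c where "c \<in> carrier G" "conjugate c a \<in> H"
  using assms(1)
proof (cases rule: elliptic_or_cyclically_reduced)
  case (2 c w)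
  have "conjugate c a \<otimes> conjugate c b = conjugate c b \<otimes> (conjugate c a \<otimes> conjugate c a)"
    using 2(1) assms by (simp flip: conjugate_mult)
  then have False using not_cyclically_reduced[of "conjugate c b" w] 2 assms by simp
  then show ?thesis ..
qed (use that in blast)

text \<open>Once a conjugate of \<open>a\<close> is a translation in H,
  \<open>kernel_conj_in_H\<close> applied to it and its square puts the conjugate of
  \<open>b\<close> in H. If it is not a translation and \<open>b'\<close> is outside H, then
  \<open>commute_step\<close> shows that a further conjugate in H crosses the first letter of
  \<open>b'\<close>, hence is a power of y; conjugating it by that letter gives a power of x, a
  translation.\<close>

lemma pair_conj_into_H:
  assumes "a \<in> carrier G" "b \<in> carrier G" "a \<otimes> b = b \<otimes> (a \<otimes> a)" "a \<noteq> \<one>"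
  obtains c where "c \<in> carrier G" "conjugate c a \<in> H" "conjugate c b \<in> H"
proof -
  have *: "b \<in> H" if "a \<in> H" "b \<in> carrier G" "a \<otimes> b = b \<otimes> (a \<otimes> a)" "a \<noteq> \<one>" "snd (aff a) = 0" for a b
    using kernel_conj_in_H[of a "a \<otimes> a" b] that by (simp add: snd_aff_mult)
  have conj_rel: "conjugate c a \<otimes> conjugate c b = conjugate c b \<otimes> (conjugate c a \<otimes> conjugate c a)" "conjugate c a \<noteq> \<one>"
    if "c \<in> carrier G" for c
  proof -
    show "conjugate c a \<otimes> conjugate c b = conjugate c b \<otimes> (conjugate c a \<otimes> conjugate c a)"
      using that assms by (simp flip: conjugate_mult)
    show "conjugate c a \<noteq> \<one>"
    proof
      assume "conjugate c a = \<one>"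
      then have "a \<otimes> c = c" using that assms(1) by (simp add: conjugate_def m_assoc inv_solve_left')
      then show False using that assms(1,4) by simp
    qed
  qed
  obtain c where c: "c \<in> carrier G" "conjugate c a \<in> H" using conj_into_H assms(1-3) by blast
  define a' b' where "a' = conjugate c a" and "b' = conjugate c b"
  have b': "b' \<in> carrier G" using c assms(2) by (simp add: b'_def)
  show thesis
  proof (cases "snd (aff a') = 0 \<or> b' \<in> H")
    case True
    then show thesis using that[OF c] *[of a' b'] c b' conj_rel by (auto simp: a'_def b'_def)
  next
    case False
    obtain w h where w: "reduced w" "h \<in> H" "b' = val w h"
      using reduced_form[OF b'] by blast
    with False obtain k e v where v: "w = (k, e) # v" by (cases w) auto
    then have k: "k \<in> H" using w by (simp add: reduced_Cons)
    obtain a1 where a1: "a1 \<in> H" "rep (\<not> e) (aff (conjugate k a')) = (0, 0)"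
        "aff a1 = pass (\<not> e) (aff (conjugate k a'))"
        "stable (\<not> e) \<otimes> conjugate k a' = a1 \<otimes> stable (\<not> e)"
      using commute_step[of k e v h a' "a' \<otimes> a'"] w v c conj_rel[OF c(1)]
      unfolding a'_def b'_def conjugate_def by (metis H_mult)
    have "snd (aff (conjugate k a')) \<noteq> 0"
      using False snd_aff_conj[OF k, of a'] c by (simp add: a'_def conjugate_def)
    with a1(2) have "\<not> e" by (auto simp: rep_eq_one_iff)
    then have "snd (aff a1) = 0"
      using a1(3) by (cases "aff (conjugate k a')") simp
    define d where "d = c \<otimes> (k \<otimes> stable e)"
    have d: "d \<in> carrier G" using c k by (simp add: d_def)
    have "conjugate d a = conjugate (stable e) (conjugate k a')"
      using c k assms(1) by (simp add: d_def a'_def conjugate_conjugate m_assoc)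
    also have "\<dots> = a1"
    proof -
      have "inv (stable e) = stable (\<not> e)" by (simp add: stable_def)
      then show ?thesis using a1(1,4) by (simp add: conjugate_def[of "stable e"] m_assoc)
    qed
    finally have da: "conjugate d a = a1" .
    have "conjugate d b \<in> H"
    proof (rule *)
      show "conjugate d a \<in> H" using a1(1) by (simp add: da)
      show "snd (aff (conjugate d a)) = 0" using \<open>snd (aff a1) = 0\<close> by (simp add: da)
    qed (use conj_rel[OF d] d assms(2) in simp_all)
    then show thesis using that[OF d] a1(1) by (simp add: da)
  qed
qed

end


section \<open>Automorphisms\<close>

context gersten_action
begin

text \<open>Applied to the images of x, y, t under an automorphism.\<close>

lemma normalise_triple:
  assumes "a \<in> carrier G" "b \<in> carrier G" "s \<in> carrier G"
    and "a \<otimes> b = b \<otimes> (a \<otimes> a)" "a \<otimes> s = s \<otimes> b" "a \<noteq> \<one>"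
  obtains c g where "c \<in> carrier G" "g \<in> H" "x \<otimes> g = g \<otimes> x"
    "conjugate c a = x" "conjugate c b = y" "conjugate c s = g \<otimes> t"
proof -
  have conj_ne: "conjugate c a \<noteq> \<one>" if "c \<in> carrier G" for c
  proof
    assume "conjugate c a = \<one>"
    then have "a \<otimes> c = c" using that assms(1) by (simp add: conjugate_def m_assoc inv_solve_left')
    then show False using that assms(1,6) by simp
  qed
  obtain c1 where c1: "c1 \<in> carrier G" "conjugate c1 a \<in> H" "conjugate c1 b \<in> H"
    using pair_conj_into_H[OF assms(1,2,4,6)] by blast
  define a1 b1 where "a1 = conjugate c1 a" and "b1 = conjugate c1 b"
  have ab1: "a1 \<in> H" "b1 \<in> H" using c1 by (auto simp: a1_def b1_def)
  have "a1 \<otimes> b1 = b1 \<otimes> (a1 \<otimes> a1)"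
    using c1 assms(1,2,4) by (simp add: a1_def b1_def flip: conjugate_mult)
  then have eq: "aff a1 \<bullet> aff b1 = aff b1 \<bullet> (aff a1 \<bullet> aff a1)"
    using ab1 by (simp flip: aff_hom(4))
  \<comment> \<open>Exponent sums in the relation read n + m = m + 2 n, so \<open>a1\<close> is a
    translation.\<close>
  obtain q where q: "aff a1 = (q, 0)"
    using arg_cong[OF eq, of snd] by (cases "aff a1") (simp add: snd_aff_mult)
  have "q \<noteq> 0" using aff_eq_one[OF ab1(1)] conj_ne[OF c1(1)] q by (auto simp: a1_def)
  \<comment> \<open>The translation parts give q = 2 q 2^-m, so \<open>b1\<close> has slope
    1/2.\<close>
  have "2 * 2 powi - snd (aff b1) = (1 :: rat)"
    using arg_cong[OF eq, of fst] \<open>q \<noteq> 0\<close> q by (simp add: aff_mult_def)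
  then have "2 powi (1 - snd (aff b1)) = (1 :: rat)"
    by (simp add: power_int_diff power_int_minus field_simps)
  then obtain r where r: "aff b1 = (r, 1)"
    by (cases "aff b1") (simp add: two_powi_eq_one_iff)
  \<comment> \<open>\<open>b1\<close> is v \<mapsto> r + v / 2, with fixed point 2 r, and
    \<open>c2\<close> is the translation by 2 r. It conjugates \<open>b1\<close> to y and commutes
    with the translation \<open>a1\<close>.\<close>
  define c2 where "c2 = inv y \<otimes> b1"
  have c2: "c2 \<in> H" "aff c2 = (2 * r, 0)"
    using ab1 r by (simp_all add: c2_def) (simp add: aff_mult_def aff_inv_def)
  have conj_eqI: "conjugate c d = e" if "c \<in> H" "d \<in> H" "e \<in> H" "aff d \<bullet> aff c = aff c \<bullet> aff e" for c d e
  proof -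
    have "d \<otimes> c = c \<otimes> e" using that by (intro aff_inj) auto
    then show ?thesis using that(1-3) by (simp add: conjugate_def m_assoc inv_solve_left')
  qed
  have conj2: "conjugate c2 b1 = y" "conjugate c2 a1 = a1"
    by (rule conj_eqI; use c2 ab1 r q in \<open>simp add: aff_mult_def power_int_minus\<close>)+
  \<comment> \<open>Since t conjugates x to y, an element s' conjugating z to y gives s' t^-1
    conjugating z to x.\<close>
  have inv_t: "z \<in> carrier G \<Longrightarrow> s' \<in> carrier G \<Longrightarrow> z \<otimes> s' = s' \<otimes> y \<Longrightarrow>
      z \<otimes> (s' \<otimes> inv t) = (s' \<otimes> inv t) \<otimes> x" for z s'
  proof -
    assume z: "z \<in> carrier G" "s' \<in> carrier G" "z \<otimes> s' = s' \<otimes> y"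
    have "inv t \<otimes> x = y \<otimes> inv t"
      using rel_xt by (simp add: inv_solve_left' inv_solve_right flip: m_assoc) (simp add: m_assoc l_inv_cancel)
    then have "(s' \<otimes> inv t) \<otimes> x = (s' \<otimes> y) \<otimes> inv t" using z by (simp add: m_assoc)
    also have "\<dots> = (z \<otimes> s') \<otimes> inv t" by (simp only: z(3))
    also have "\<dots> = z \<otimes> (s' \<otimes> inv t)" using z(1,2) by (simp add: m_assoc)
    finally show ?thesis by (rule sym)
  qed
  define c3 where "c3 = c1 \<otimes> c2"
  define s3 where "s3 = conjugate c3 s"
  have c3: "c3 \<in> carrier G" "conjugate c3 a = a1" "conjugate c3 b = y"
    using c1 c2 assms(1,2) conj2 by (simp_all add: c3_def a1_def b1_def flip: conjugate_conjugate)
  have conj_s: "conjugate c a \<otimes> conjugate c s = conjugate c s \<otimes> conjugate c b" if "c \<in> carrier G" for c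
    using that assms(1-3,5) by (simp flip: conjugate_mult)
  have s3: "s3 \<in> carrier G" "a1 \<otimes> s3 = s3 \<otimes> y"
    using c3 assms(3) conj_s[OF c3(1)] by (simp_all add: s3_def)
  define w where "w = s3 \<otimes> inv t"
  have w_comm: "a1 \<otimes> w = w \<otimes> x" unfolding w_def using inv_t s3 ab1 by simp
  have w: "w \<in> H"
  proof (rule kernel_conj_in_H)
    show "a1 \<noteq> \<one>" using conj_ne[OF c1(1)] by (simp add: a1_def)
  qed (use ab1 q w_comm s3 in \<open>auto simp: w_def\<close>)
  obtain p k where pk: "aff w = (p, k)" by (cases "aff w")
  have "aff a1 \<bullet> aff w = aff w \<bullet> (1, 0)" using w_comm w ab1 by (metis H_gens(1) aff_hom(2,4))
  then have "q = 2 powi - k" using q pk by (simp add: aff_mult_def)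
  \<comment> \<open>Both \<open>w\<close> and y^k have slope 2^-k, so y^k also conjugates
    \<open>a1\<close> to x; unlike a general \<open>w\<close>, it fixes y.\<close>
  define c4 where "c4 = y [^] k"
  have c4: "c4 \<in> H" "aff c4 = (0, k)" by (simp_all add: c4_def aff_int_pow)
  have conj4: "conjugate c4 a1 = x" "conjugate c4 y = y"
    by (rule conj_eqI; use c4 ab1 q \<open>q = _\<close> in \<open>simp add: aff_mult_def\<close>)+
  define c5 where "c5 = c3 \<otimes> c4"
  define g where "g = conjugate c5 s \<otimes> inv t"
  have c5: "c5 \<in> carrier G" "conjugate c5 a = x" "conjugate c5 b = y"
    using c3 c4 assms(1,2) conj4 by (simp_all add: c5_def flip: conjugate_conjugate)
  have "x \<otimes> conjugate c5 s = conjugate c5 s \<otimes> y"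
    using conj_s[OF c5(1)] c5(2,3) by simp
  then have g_comm: "x \<otimes> g = g \<otimes> x"
    unfolding g_def using inv_t c5 assms(3) by simp
  have "g \<in> H"
  proof (rule kernel_conj_in_H)
    show "x \<noteq> \<one>" using aff_hom(1,2) by force
  qed (use g_comm c5 assms(3) in \<open>auto simp: g_def\<close>)
  moreover have "conjugate c5 s = g \<otimes> t"
    using c5 assms(3) by (simp add: g_def m_assoc)
  ultimately show thesis using that c5 g_comm by blast
qed

text \<open>Commuting with v \<mapsto> v + 1 forces slope 1, and translations commute.\<close>

lemma centralizer_x_comm:
  assumes "g \<in> H" "h \<in> H" "g \<otimes> x = x \<otimes> g" "h \<otimes> x = x \<otimes> h"
  shows "g \<otimes> h = h \<otimes> g"
proof -
  have "snd (aff g) = 0" if "g \<in> H" "g \<otimes> x = x \<otimes> g" for g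
  proof -
    have "aff g \<bullet> (1, 0) = (1, 0) \<bullet> aff g" using that by (metis H_gens(1) aff_hom(2,4))
    then show ?thesis by (simp add: aff_mult_def two_powi_eq_one_iff)
  qed
  with assms show ?thesis by (intro aff_inj) (auto simp: aff_mult_def)
qed

end

lemma hom_eq_on_generate:
  assumes "group_hom G K f" "group_hom G K h" "S \<subseteq> carrier G" "\<And>s. s \<in> S \<Longrightarrow> f s = h s"
    and "g \<in> generate G S"
  shows "f g = h g"
proof -
  interpret f: group_hom G K f by fact
  interpret h: group_hom G K h by fact
  from assms(5) show ?thesis
  proof (induction rule: generate.induct)
    case (eng h1 h2)
    then show ?case using f.G.generate_in_carrier[OF assms(3)] by simp
  qed (use assms(3,4) in auto)
qed

section \<open>Inner automorphisms and outer classes\<close>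

definition inner :: "('a, 'b) monoid_scheme \<Rightarrow> 'a \<Rightarrow> 'a \<Rightarrow> 'a" where
  "inner G g = (\<lambda>h\<in>carrier G. g \<otimes>\<^bsub>G\<^esub> h \<otimes>\<^bsub>G\<^esub> inv\<^bsub>G\<^esub> g)"

context group
begin

lemma Inn_eq: "Inn G = inner G ` carrier G"
  by (auto simp: Inn_def inner_def)

lemma mult_AutoGroup:
  "f \<in> auto G \<Longrightarrow> h \<in> auto G \<Longrightarrow> f \<otimes>\<^bsub>AutoGroup G\<^esub> h = compose (carrier G) f h"
  by (simp add: AutoGroup_def BijGroup_def auto_def)

lemma carrier_AutoGroup [simp]: "carrier (AutoGroup G) = auto G"
  by (simp add: AutoGroup_def)

lemma one_AutoGroup: "\<one>\<^bsub>AutoGroup G\<^esub> = (\<lambda>h\<in>carrier G. h)"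
  by (simp add: AutoGroup_def BijGroup_def)

lemma inner_compose:
  "a \<in> carrier G \<Longrightarrow> b \<in> carrier G \<Longrightarrow>
    compose (carrier G) (inner G a) (inner G b) = inner G (a \<otimes> b)"
  by (auto simp: compose_def inner_def fun_eq_iff inv_mult_group m_assoc)

lemma inner_one: "inner G \<one> = (\<lambda>h\<in>carrier G. h)"
  by (auto simp: inner_def)

lemma auto_I:
  assumes "f \<in> hom G G" "f \<in> extensional (carrier G)" "f' \<in> hom G G"
    and "\<And>h. h \<in> carrier G \<Longrightarrow> f (f' h) = h" "\<And>h. h \<in> carrier G \<Longrightarrow> f' (f h) = h"
  shows "f \<in> auto G"
proof -
  have "bij_betw f (carrier G) (carrier G)"
    by (rule bij_betw_byWitness[where f' = f']) (use assms hom_in_carrier in \<open>auto simp: hom_def\<close>)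
  then show ?thesis using assms by (simp add: auto_def Bij_def)
qed

lemma inner_auto: "a \<in> carrier G \<Longrightarrow> inner G a \<in> auto G"
  by (rule auto_I[where f' = "inner G (inv a)"])
    (auto simp: inner_def hom_def m_assoc l_inv_cancel r_inv_cancel)

lemma Inn_normal: "Inn G \<lhd> AutoGroup G"
proof -
  interpret A: group "AutoGroup G" by (rule AutoGroup)
  have inv: "inv\<^bsub>AutoGroup G\<^esub> (inner G a) = inner G (inv a)" if "a \<in> carrier G" for a
    by (rule A.inv_equality)
      (use that in \<open>simp_all add: inner_auto mult_AutoGroup inner_compose one_AutoGroup inner_one\<close>)
  have "subgroup (Inn G) (AutoGroup G)"
    by (rule A.subgroupI)
      (auto simp: Inn_eq inner_auto inv mult_AutoGroup inner_compose)
  moreover have "f \<otimes>\<^bsub>AutoGroup G\<^esub> inner G a \<otimes>\<^bsub>AutoGroup G\<^esub> inv\<^bsub>AutoGroup G\<^esub> f \<in> Inn G"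
    if f: "f \<in> auto G" and a: "a \<in> carrier G" for f a
  proof -
    interpret f: group_hom G G f using f by unfold_locales (simp add: auto_def)
    have "compose (carrier G) f (inner G a) = compose (carrier G) (inner G (f a)) f"
      using a by (auto simp: compose_def inner_def fun_eq_iff)
    then have "f \<otimes>\<^bsub>AutoGroup G\<^esub> inner G a = inner G (f a) \<otimes>\<^bsub>AutoGroup G\<^esub> f"
      using f a by (simp add: mult_AutoGroup inner_auto)
    moreover have "f \<in> carrier (AutoGroup G)" "inner G a \<in> carrier (AutoGroup G)"
      "inner G (f a) \<in> carrier (AutoGroup G)"
      using f a by (simp_all add: inner_auto)
    ultimately have "f \<otimes>\<^bsub>AutoGroup G\<^esub> inner G a \<otimes>\<^bsub>AutoGroup G\<^esub> inv\<^bsub>AutoGroup G\<^esub> f = inner G (f a)"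
      by (subst A.inv_solve_right') (auto simp del: carrier_AutoGroup)
    then show ?thesis using a by (simp add: Inn_eq)
  qed
  ultimately show ?thesis by (auto simp: A.normal_inv_iff Inn_eq)
qed

lemma out_class_eq_iff:
  assumes "f \<in> auto G" "f' \<in> auto G"
  shows "out_class G f = out_class G f' \<longleftrightarrow>
    (\<exists>a\<in>carrier G. f = compose (carrier G) (inner G a) f')"
proof -
  interpret A: group "AutoGroup G" by (rule AutoGroup)
  interpret N: normal "Inn G" "AutoGroup G" by (rule Inn_normal)
  have "out_class G f = out_class G f' \<longleftrightarrow> f \<in> Inn G #>\<^bsub>AutoGroup G\<^esub> f'"
    using A.rcos_self[OF _ N.subgroup_axioms, of f] A.repr_independence[OF _ _ N.subgroup_axioms, of f f'] assms
    by (auto simp: out_class_def)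
  also have "\<dots> \<longleftrightarrow> (\<exists>a\<in>carrier G. f = compose (carrier G) (inner G a) f')"
    using assms(2) by (auto simp: r_coset_def Inn_eq mult_AutoGroup inner_auto)
  finally show ?thesis .
qed

end

section \<open>The maps F_g and their outer classes\<close>

interpretation BG: group BG by (rule group_BG)

lemma hom_BG_eqI:
  assumes "f \<in> hom BG BG" "h \<in> hom BG BG" "f BG_x = h BG_x" "f BG_y = h BG_y" "f BG_t = h BG_t"
    and "g \<in> carrier BG"
  shows "f g = h g"
proof (rule hom_eq_on_generate[of BG BG f h "{BG_x, BG_y, BG_t}" g])
  show "group_hom BG BG f" "group_hom BG BG h" using assms by unfold_locales
  show "g \<in> generate BG {BG_x, BG_y, BG_t}" using assms(6) by (simp add: BG_generate)
qed (use assms BG_gens_closed in auto)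

lemma BG_gersten_action:
  obtains act where "gersten_action BG BG_x BG_y BG_t act"
proof -
  obtain act where act: "act \<in> hom BG (BijGroup nfs)"
    "act BG_x = left_mult (1, 0)" "act BG_y = left_mult (0, 1)" "act BG_t = stable_letter True"
    using BG_action .
  interpret act: group_hom BG "BijGroup nfs" act
    using group_BijGroup act(1) by (simp add: group_hom_def group_hom_axioms_def group_BG)
  have Bij: "act g \<in> Bij nfs" if "g \<in> carrier BG" for g
    using act.hom_closed[OF that] by (simp add: BijGroup_def)
  have "gersten_action BG BG_x BG_y BG_t act"
  proof
    show "BG_x \<otimes>\<^bsub>BG\<^esub> BG_y = BG_y \<otimes>\<^bsub>BG\<^esub> (BG_x \<otimes>\<^bsub>BG\<^esub> BG_x)" "BG_x \<otimes>\<^bsub>BG\<^esub> BG_t = BG_t \<otimes>\<^bsub>BG\<^esub> BG_y"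
      using BG_relations BG_gens_closed by (simp_all add: conj_by_def BG.m_assoc BG.inv_solve_left')
    show "act g s \<in> nfs" if "g \<in> carrier BG" "s \<in> nfs" for g s
      using Bij_imp_funcset[OF Bij[OF that(1)]] that(2) by blast
    show "act \<one>\<^bsub>BG\<^esub> s = s" if "s \<in> nfs" for s
      using that by (simp add: BijGroup_def)
    show "act (g \<otimes>\<^bsub>BG\<^esub> h) s = act g (act h s)"
      if "g \<in> carrier BG" "h \<in> carrier BG" "s \<in> nfs" for g h s
      using that Bij by (simp add: BijGroup_def compose_def)
  qed (auto simp: BG_gens_closed BG_generate act left_mult_def stable_letter_def)
  then show thesis by (rule that)
qed

lemma BG_C_subgroup: "subgroup BG_C BG"
proof (rule BG.subgroupI)
  have H: "subgroup BG_H BG"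
    unfolding BG_H_def by (rule BG.generate_is_subgroup) (simp add: BG_gens_closed)
  note H_carrier = subgroup.mem_carrier[OF H]
  show "BG_C \<subseteq> carrier BG" using H_carrier by (auto simp: BG_C_def)
  show "BG_C \<noteq> {}"
    using subgroup.one_closed[OF H] BG_gens_closed by (auto simp: BG_C_def)
  show "inv\<^bsub>BG\<^esub> g \<in> BG_C" if "g \<in> BG_C" for g
  proof -
    have g: "g \<in> BG_H" "g \<otimes>\<^bsub>BG\<^esub> BG_x = BG_x \<otimes>\<^bsub>BG\<^esub> g" using that by (auto simp: BG_C_def)
    have carr: "g \<in> carrier BG" "BG_x \<in> carrier BG" using g(1) H_carrier BG_gens_closed by auto
    have "inv\<^bsub>BG\<^esub> g \<otimes>\<^bsub>BG\<^esub> BG_x = inv\<^bsub>BG\<^esub> g \<otimes>\<^bsub>BG\<^esub> (BG_x \<otimes>\<^bsub>BG\<^esub> g) \<otimes>\<^bsub>BG\<^esub> inv\<^bsub>BG\<^esub> g"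
      using carr by (simp add: BG.m_assoc)
    also have "\<dots> = inv\<^bsub>BG\<^esub> g \<otimes>\<^bsub>BG\<^esub> (g \<otimes>\<^bsub>BG\<^esub> BG_x) \<otimes>\<^bsub>BG\<^esub> inv\<^bsub>BG\<^esub> g" by (simp only: g(2))
    also have "\<dots> = BG_x \<otimes>\<^bsub>BG\<^esub> inv\<^bsub>BG\<^esub> g" using carr by (simp add: BG.l_inv_cancel)
    finally have "inv\<^bsub>BG\<^esub> g \<otimes>\<^bsub>BG\<^esub> BG_x = BG_x \<otimes>\<^bsub>BG\<^esub> inv\<^bsub>BG\<^esub> g" .
    then show ?thesis using g(1) subgroup.m_inv_closed[OF H] by (simp add: BG_C_def)
  qed
  show "g \<otimes>\<^bsub>BG\<^esub> h \<in> BG_C" if "g \<in> BG_C" "h \<in> BG_C" for g h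
  proof -
    have gh: "g \<in> BG_H" "g \<otimes>\<^bsub>BG\<^esub> BG_x = BG_x \<otimes>\<^bsub>BG\<^esub> g"
      "h \<in> BG_H" "h \<otimes>\<^bsub>BG\<^esub> BG_x = BG_x \<otimes>\<^bsub>BG\<^esub> h" using that by (auto simp: BG_C_def)
    then have carr: "g \<in> carrier BG" "h \<in> carrier BG" using H_carrier by auto
    have "g \<otimes>\<^bsub>BG\<^esub> h \<otimes>\<^bsub>BG\<^esub> BG_x = g \<otimes>\<^bsub>BG\<^esub> BG_x \<otimes>\<^bsub>BG\<^esub> h"
      using gh(4) carr BG_gens_closed(1) by (simp add: BG.m_assoc)
    also have "\<dots> = BG_x \<otimes>\<^bsub>BG\<^esub> (g \<otimes>\<^bsub>BG\<^esub> h)"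
      using gh(2) carr BG_gens_closed(1) by (simp add: BG.m_assoc)
    finally show ?thesis using gh subgroup.m_closed[OF H] by (simp add: BG_C_def)
  qed
qed

lemma BG_C_carrier: "g \<in> BG_C \<Longrightarrow> g \<in> carrier BG"
  using BG_C_subgroup by (rule subgroup.mem_carrier)

lemma BG_endo_unique: "is_BG_endo g F \<Longrightarrow> is_BG_endo g F' \<Longrightarrow> F = F'"
  unfolding is_BG_endo_def by (rule extensionalityI[of _ "carrier BG"]) (simp_all add: hom_BG_eqI)

text \<open>As g centralises x, the element g t conjugates x to y just as t does; the other relation
  does not involve t.\<close>

lemma BG_endo_exists:
  assumes "g \<in> BG_C"
  obtains F where "is_BG_endo g F"
proof -
  have g: "g \<in> carrier BG" "g \<otimes>\<^bsub>BG\<^esub> BG_x = BG_x \<otimes>\<^bsub>BG\<^esub> g"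
    using assms BG_C_carrier by (auto simp: BG_C_def)
  have xt: "BG_x \<otimes>\<^bsub>BG\<^esub> BG_t = BG_t \<otimes>\<^bsub>BG\<^esub> BG_y"
    using BG_relations(2) BG_gens_closed by (simp add: conj_by_def BG.m_assoc BG.inv_solve_left')
  have "BG_x \<otimes>\<^bsub>BG\<^esub> (g \<otimes>\<^bsub>BG\<^esub> BG_t) = g \<otimes>\<^bsub>BG\<^esub> (BG_x \<otimes>\<^bsub>BG\<^esub> BG_t)"
    using g BG_gens_closed by (simp flip: BG.m_assoc)
  then have "conj_by BG BG_x (g \<otimes>\<^bsub>BG\<^esub> BG_t) = BG_y"
    by (intro conj_by_eqI) (use g BG_gens_closed group_BG in \<open>simp_all add: xt BG.m_assoc\<close>)
  then obtain F where F: "F \<in> hom BG BG" "F BG_x = BG_x" "F BG_y = BG_y" "F BG_t = g \<otimes>\<^bsub>BG\<^esub> BG_t"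
    using BG_universal[OF group_BG BG_gens_closed(1,2) BG.m_closed[OF g(1) BG_gens_closed(3)] BG_relations(1)]
    by blast
  moreover from F(1) have "restrict F (carrier BG) \<in> hom BG BG" by (simp add: hom_def Pi_iff)
  ultimately have "is_BG_endo g (restrict F (carrier BG))"
    by (simp add: is_BG_endo_def BG_gens_closed)
  then show thesis by (rule that)
qed

lemma BG_endo_ex1: "g \<in> BG_C \<Longrightarrow> \<exists>!F. is_BG_endo g F"
  using BG_endo_exists BG_endo_unique by metis

lemma BG_F_endo:
  assumes "g \<in> BG_C"
  shows "is_BG_endo g (BG_F g)"
  unfolding BG_F_def by (rule theI'[OF BG_endo_ex1[OF assms]])

lemma BG_F_eqI: "g \<in> BG_C \<Longrightarrow> is_BG_endo g F \<Longrightarrow> BG_F g = F"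
  using BG_F_endo BG_endo_unique by metis

lemma BG_endo_fixes_H:
  assumes "is_BG_endo g F" "h \<in> BG_H"
  shows "F h = h"
proof (rule hom_eq_on_generate[of BG BG F "\<lambda>h. h" "{BG_x, BG_y}" h])
  show "group_hom BG BG F" using assms(1) by unfold_locales (simp add: is_BG_endo_def)
  show "group_hom BG BG (\<lambda>h. h)" by unfold_locales (simp add: hom_def)
  show "h \<in> generate BG {BG_x, BG_y}" using assms(2) by (simp add: BG_H_def)
qed (use assms(1) BG_gens_closed in \<open>auto simp: is_BG_endo_def\<close>)

lemma BG_C_comm:
  assumes "g \<in> BG_C" "h \<in> BG_C"
  shows "g \<otimes>\<^bsub>BG\<^esub> h = h \<otimes>\<^bsub>BG\<^esub> g"
proof -
  obtain act where "gersten_action BG BG_x BG_y BG_t act" using BG_gersten_action .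
  then interpret gersten_action BG BG_x BG_y BG_t act .
  show ?thesis by (rule centralizer_x_comm) (use assms in \<open>auto simp: BG_C_def BG_H_def H_def\<close>)
qed

text \<open>F_g fixes h, so the composite sends t to h g t, in the wrong order;
  \<open>BG_C_comm\<close> repairs this.\<close>

lemma BG_F_compose:
  assumes "g \<in> BG_C" "h \<in> BG_C"
  shows "compose (carrier BG) (BG_F g) (BG_F h) = BG_F (g \<otimes>\<^bsub>BG\<^esub> h)"
proof (rule BG_F_eqI[symmetric])
  show "g \<otimes>\<^bsub>BG\<^esub> h \<in> BG_C" using assms subgroup.m_closed[OF BG_C_subgroup] by blast
  note F = BG_F_endo[OF assms(1)] BG_F_endo[OF assms(2)]
  then have hom: "BG_F g \<in> hom BG BG" "BG_F h \<in> hom BG BG" by (auto simp: is_BG_endo_def)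
  have "BG_F g (h \<otimes>\<^bsub>BG\<^esub> BG_t) = BG_F g h \<otimes>\<^bsub>BG\<^esub> BG_F g BG_t"
    using hom(1) assms(2) BG_C_carrier BG_gens_closed by (intro hom_mult)
  also have "\<dots> = h \<otimes>\<^bsub>BG\<^esub> (g \<otimes>\<^bsub>BG\<^esub> BG_t)"
    using BG_endo_fixes_H[OF F(1), of h] F(1) assms(2) by (simp add: BG_C_def is_BG_endo_def)
  also have "\<dots> = g \<otimes>\<^bsub>BG\<^esub> h \<otimes>\<^bsub>BG\<^esub> BG_t"
    using BG_C_comm[OF assms] assms BG_C_carrier BG_gens_closed by (simp flip: BG.m_assoc)
  finally have "BG_F g (h \<otimes>\<^bsub>BG\<^esub> BG_t) = g \<otimes>\<^bsub>BG\<^esub> h \<otimes>\<^bsub>BG\<^esub> BG_t" .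
  moreover have "compose (carrier BG) (BG_F g) (BG_F h) \<in> hom BG BG"
    by (rule BG.hom_compose[OF hom(2,1)])
  ultimately show "is_BG_endo (g \<otimes>\<^bsub>BG\<^esub> h) (compose (carrier BG) (BG_F g) (BG_F h))"
    using F by (simp add: is_BG_endo_def compose_eq BG_gens_closed)
qed

lemma BG_F_one: "BG_F \<one>\<^bsub>BG\<^esub> = (\<lambda>h\<in>carrier BG. h)"
  by (rule BG_F_eqI)
    (auto simp: is_BG_endo_def BG_gens_closed hom_def subgroup.one_closed[OF BG_C_subgroup])

lemma BG_F_auto:
  assumes "g \<in> BG_C"
  shows "BG_F g \<in> auto BG"
proof (rule BG.auto_I)
  have inv: "inv\<^bsub>BG\<^esub> g \<in> BG_C" using assms by (rule subgroup.m_inv_closed[OF BG_C_subgroup])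
  show "BG_F g \<in> hom BG BG" "BG_F g \<in> extensional (carrier BG)" "BG_F (inv\<^bsub>BG\<^esub> g) \<in> hom BG BG"
    using BG_F_endo assms inv by (auto simp: is_BG_endo_def)
  show "BG_F g (BG_F (inv\<^bsub>BG\<^esub> g) h) = h" if "h \<in> carrier BG" for h
    using fun_cong[OF BG_F_compose[OF assms inv], of h] that assms
    by (simp add: compose_eq BG_F_one BG_C_carrier)
  show "BG_F (inv\<^bsub>BG\<^esub> g) (BG_F g h) = h" if "h \<in> carrier BG" for h
    using fun_cong[OF BG_F_compose[OF inv assms], of h] that assms
    by (simp add: compose_eq BG_F_one BG_C_carrier)
qed

lemma out_class_BG_F_inj:
  assumes "g \<in> BG_C" "h \<in> BG_C" "out_class BG (BG_F g) = out_class BG (BG_F h)"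
  shows "g = h"
proof -
  obtain act where "gersten_action BG BG_x BG_y BG_t act" using BG_gersten_action .
  then interpret gersten_action BG BG_x BG_y BG_t act .
  obtain a where a: "a \<in> carrier BG" "BG_F g = compose (carrier BG) (inner BG a) (BG_F h)"
    using assms BG.out_class_eq_iff BG_F_auto by blast
  note F = BG_F_endo[OF assms(1), unfolded is_BG_endo_def] BG_F_endo[OF assms(2), unfolded is_BG_endo_def]
  have conj_fixes: "a \<otimes>\<^bsub>BG\<^esub> z \<otimes>\<^bsub>BG\<^esub> inv\<^bsub>BG\<^esub> a = z" if "z \<in> {BG_x, BG_y}" for z
    using fun_cong[OF a(2), of z] that F by (auto simp: compose_eq inner_def)
  \<comment> \<open>F_g and F_h both fix x and y, so the inner automorphism between them does
    too.\<close>
  have "a \<otimes>\<^bsub>BG\<^esub> z = z \<otimes>\<^bsub>BG\<^esub> a" if "z \<in> {BG_x, BG_y}" for z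
    by (rule iffD1[OF BG.inv_solve_right' conj_fixes[OF that]]) (use that a(1) in auto)
  then have "a = \<one>\<^bsub>BG\<^esub>" using centralizer_H_trivial[OF a(1)] by simp
  then have "BG_F g BG_t = BG_F h BG_t"
    using a(2) F BG.m_closed[OF BG_C_carrier[OF assms(2)] gens(3)]
    by (simp add: compose_eq BG.inner_one)
  then show ?thesis using F assms(1,2) BG_C_carrier by simp
qed

lemma out_class_BG_F_surj:
  assumes "f \<in> auto BG"
  obtains g where "g \<in> BG_C" "out_class BG f = out_class BG (BG_F g)"
proof -
  obtain act where "gersten_action BG BG_x BG_y BG_t act" using BG_gersten_action .
  then interpret gersten_action BG BG_x BG_y BG_t act .
  interpret f: group_hom BG BG f using assms by unfold_locales (simp add: auto_def)
  have inj: "inj_on f (carrier BG)" using assms by (simp add: auto_def Bij_def bij_betw_def)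
  have "BG_x \<noteq> \<one>\<^bsub>BG\<^esub>" using aff_hom(1,2) by force
  then have "f BG_x \<noteq> \<one>\<^bsub>BG\<^esub>"
    using inj_on_eq_iff[OF inj, of BG_x "\<one>\<^bsub>BG\<^esub>"] by simp
  moreover have "f BG_x \<otimes>\<^bsub>BG\<^esub> f BG_y = f BG_y \<otimes>\<^bsub>BG\<^esub> (f BG_x \<otimes>\<^bsub>BG\<^esub> f BG_x)"
    "f BG_x \<otimes>\<^bsub>BG\<^esub> f BG_t = f BG_t \<otimes>\<^bsub>BG\<^esub> f BG_y"
    using arg_cong[OF rel_xy, of f] arg_cong[OF rel_xt, of f] by simp_all
  ultimately obtain c g where c: "c \<in> carrier BG" and g: "g \<in> H" "BG_x \<otimes>\<^bsub>BG\<^esub> g = g \<otimes>\<^bsub>BG\<^esub> BG_x"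
    and conjugate: "conjugate c (f BG_x) = BG_x" "conjugate c (f BG_y) = BG_y" "conjugate c (f BG_t) = g \<otimes>\<^bsub>BG\<^esub> BG_t"
    using normalise_triple[of "f BG_x" "f BG_y" "f BG_t"] f.hom_closed gens by metis
  have gC: "g \<in> BG_C" using g by (simp add: BG_C_def BG_H_def H_def)
  \<comment> \<open>\<open>inner\<close> conjugates as a h a^-1 and \<open>conjugate\<close> as c^-1
    h c, hence the inverse.\<close>
  have auto: "inner BG (inv\<^bsub>BG\<^esub> c) \<in> auto BG" using c by (simp add: BG.inner_auto)
  have "is_BG_endo g (compose (carrier BG) (inner BG (inv\<^bsub>BG\<^esub> c)) f)"
  proof -
    have "compose (carrier BG) (inner BG (inv\<^bsub>BG\<^esub> c)) f \<in> hom BG BG"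
      by (rule BG.hom_compose[of f BG _ BG]) (use assms auto in \<open>simp_all add: auto_def\<close>)
    moreover have "inner BG (inv\<^bsub>BG\<^esub> c) z = conjugate c z" if "z \<in> carrier BG" for z
      using that c by (simp add: inner_def conjugate_def)
    ultimately show ?thesis using conjugate by (simp add: is_BG_endo_def compose_eq)
  qed
  then have "BG_F g = compose (carrier BG) (inner BG (inv\<^bsub>BG\<^esub> c)) f"
    by (rule BG_F_eqI[OF gC])
  then have "out_class BG (BG_F g) = out_class BG f"
    using BG.out_class_eq_iff[OF BG_F_auto[OF gC] assms] c by blast
  then show thesis using that[OF gC] by simp
qed

lemma out_class_BG_F_iso:
  "(\<lambda>g. out_class BG (BG_F g)) \<in> iso (BG\<lparr>carrier := BG_C\<rparr>) (Out BG)"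
proof (rule isoI)
  interpret N: normal "Inn BG" "AutoGroup BG" by (rule BG.Inn_normal)
  have carrier: "carrier (Out BG) = out_class BG ` auto BG"
    by (auto simp: Out_def carrier_FactGroup out_class_def)
  show "(\<lambda>g. out_class BG (BG_F g)) \<in> hom (BG\<lparr>carrier := BG_C\<rparr>) (Out BG)"
  proof (rule homI)
    show "out_class BG (BG_F g) \<in> carrier (Out BG)" if "g \<in> carrier (BG\<lparr>carrier := BG_C\<rparr>)" for g
      using that BG_F_auto by (simp add: carrier)
    show "out_class BG (BG_F (g \<otimes>\<^bsub>BG\<lparr>carrier := BG_C\<rparr>\<^esub> h)) =
        out_class BG (BG_F g) \<otimes>\<^bsub>Out BG\<^esub> out_class BG (BG_F h)"
      if "g \<in> carrier (BG\<lparr>carrier := BG_C\<rparr>)" "h \<in> carrier (BG\<lparr>carrier := BG_C\<rparr>)" for g h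
      using that BG_F_auto
      by (simp add: Out_def out_class_def N.rcos_sum BG.mult_AutoGroup flip: BG_F_compose)
  qed
  show "bij_betw (\<lambda>g. out_class BG (BG_F g)) (carrier (BG\<lparr>carrier := BG_C\<rparr>)) (carrier (Out BG))"
    unfolding bij_betw_def
  proof
    show "inj_on (\<lambda>g. out_class BG (BG_F g)) (carrier (BG\<lparr>carrier := BG_C\<rparr>))"
      by (rule inj_onI) (simp add: out_class_BG_F_inj)
    show "(\<lambda>g. out_class BG (BG_F g)) ` carrier (BG\<lparr>carrier := BG_C\<rparr>) = carrier (Out BG)"
      unfolding carrier using BG_F_auto out_class_BG_F_surj by simp (blast)
  qed
qed

theorem proposition3p7:
  shows "Out BG \<cong> BG\<lparr>carrier := BG_C\<rparr> \<and>
    (\<forall>g\<in>BG_C. (\<exists>!F. is_BG_endo g F) \<and> is_BG_endo g (BG_F g) \<and> BG_F g \<in> carrier (AutoGroup BG)) \<and>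
    (\<lambda>g. out_class BG (BG_F g)) \<in> iso (BG\<lparr>carrier := BG_C\<rparr>) (Out BG)"
proof -
  have "group (BG\<lparr>carrier := BG_C\<rparr>)"
    using BG_C_subgroup group_BG by (rule subgroup.subgroup_is_group)
  then have "Out BG \<cong> BG\<lparr>carrier := BG_C\<rparr>"
    using group.iso_sym is_isoI[OF out_class_BG_F_iso] by blast
  then show ?thesis
    using BG_endo_ex1 BG_F_endo BG_F_auto out_class_BG_F_iso BG.carrier_AutoGroup by blast
qed

end
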